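(* Assume the setting and standing regularity conditions of the context, and let $F$ be a real-valued functional on probability distributions on the parameter space. Put $R_n=F(W(\cdot|X^n))-F(\Phi_{\hat\theta_n,(nI(\theta_0))^{-1}}(\cdot))$. The functional of the posterior distribution function $W(\cdot|X^n)$ satisfies the following. (i) If $F(\Phi_{z,(nI(\theta_0))^{-1}}(\theta))$ is independent of $z$, then if Assumption JE holds for some $J\ge1$, $$E_{\theta_0}F(W(\theta|X^n))=F(\Phi_{\mathbf 0,(nI(\theta_0))^{-1}}(\theta))+E_{\theta_0}R_n.$$ (ii) If Assumption EE holds for some $K\ge1$, then $$E_{\theta_0}F(W(\theta|X^n))=E\,F\big(\Phi(Z+\sqrt n\,I^{1/2}(\theta_0)(\theta-\theta_0))\big)+\sum_{k=1}^K n^{-k/2}E\Big[F\big(\Phi(Z+\sqrt n\,I^{1/2}(\theta_0)(\theta-\theta_0))\big)P_k(Z)\Big]+o(n^{-K/2})h(n)+E_{\theta_0}R_n,$$ where the expectations in the first two terms on the right-hand side are with respect to $Z\sim N(\mathbf 0,I_d)$, and $$h(n)=\int\frac{F\big(\Phi(z+\sqrt n\,I^{1/2}(\theta_0)(\theta-\theta_0))\big)}{1+\|z\|^K}\,dz.$$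
   Context: Setting. $X^n=(X_1,\dots,X_n)$ is IID with density $p(\cdot|\theta)$, $\theta\in\Omega\subset\mathbb R^d$; $\theta_0$ is the data-generating value, with $P_{\theta_0}$, $E_{\theta_0}$. The prior has density $w(\theta)$; $W(\cdot|X^n)$ is the posterior distribution (function), with density $w(\theta)p(x^n|\theta)/\int w(t)p(x^n|t)\,dt$. $\hat\theta_n$ is the maximum likelihood estimator (MLE) and $I(\theta)=-E_\theta\,\partial^2\log p(X|\theta)/\partial\theta^2$ the Fisher information matrix. Standing regularity conditions (the standard "expected local sup" conditions ensuring consistency, asymptotic normality and efficiency of the MLE): $\Omega$ is closed and $\theta_0$ is in its interior; different $\theta$ give different distributions; $p(x|\theta)$ is measurable in $x$ and continuous in $\theta$; $E_{\theta_0}|\log p(X|\theta_0)|<\infty$; for each $\theta'\in\Omega$ there is $\rho>0$ with $E_{\theta_0}\sup_{|\theta-\theta'|<\rho}[\log p(X|\theta)]^+<\infty$, and there is $R>0$ with $E_{\theta_0}\sup_{|\theta|>R}[\log p(X|\theta)]^+<\infty$; $p(x|\theta)\to0$ as $|\theta|\to\infty$; the first two derivatives of $\log p(x|\theta)$ in $\theta$ exist, are continuous and are dominated near $\theta_0$ by an integrable function; $E_{\theta_0}\partial\log p(X|\theta_0)/\partial\theta=0$, and $I(\theta_0)$ is finite, positive definite and equal to the covariance matrix of the score; $w$ is a probability density, continuous and positive at $\theta_0$. Notation. $\Phi_{\mu,\Sigma}$ and $\phi_{\mu,\Sigma}$ are the distribution function and density of $N(\mu,\Sigma)$; $\Phi$,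 $\phi_d$ those of $N(\mathbf 0,I_d)$. In expressions such as $F(W(\theta|X^n))$ or $F(\Phi(z+\sqrt nI^{1/2}(\theta_0)(\theta-\theta_0)))$, $\theta$ is a dummy variable: $F$ is applied to the distribution whose distribution function is the indicated function of $\theta$ (for fixed $X^n$ or $z$). Here $\Phi_{\hat\theta_n,(nI(\theta_0))^{-1}}(\theta)=\Phi(\sqrt n\,I^{1/2}(\theta_0)(\theta-\hat\theta_n))$. All expectations and integrals appearing are taken to exist. Assumption JE (Johnson expandability of order $J$). $W_o(\cdot|X^n)$ denotes the posterior distribution function of $\psi=\sqrt n\,I^{1/2}(\theta_0)(\theta-\hat\theta_n)$ given $X^n$. A quantity $P_{W_o}(x^n)$ which is a function of the posterior is Johnson expandable of order $J$ iff there are an $N$, sets $S_n$ with $P_{\theta_0}(S_n^c)=o(1)$ and $C>0$ such that for $n>N$ and $x^n\in S_n$, $|P_{W_o}(x^n)-\sum_{j=0}^J\gamma_j(x^n)n^{-j/2}|\le Cn^{-(J+1)/2}$, where the $\gamma_j(x^n)$ depend only on $W_o(\cdot|x^n)$ and the expansion is nontrivial (the $j=0$ term is not $P_{W_o}(x^n)$ itself). For the posterior distribution itself this reads $|W_o(\psi|X^n)-\Phi(\psi)-\sum_{j=1}^J n^{-j/2}\phi_d(\psi)\gamma_j(\psi,X^n)|\le Cn^{-(J+1)/2}$ with $\gamma_j$ polynomials in $\psi$ with bounded coefficients. Assumption EE (Edgeworth expansion of order $K$). The density $f_n$ of $\hat\theta_n$ when $\theta_0$ is true satisfies $$f_n(\theta)=\phi_{\theta_0,(nI(\theta_0))^{-1}}(\theta)+\sum_{k=1}^K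 n^{-k/2}P_k(\sqrt n I^{1/2}(\theta_0)(\theta-\theta_0))\,\phi_{\theta_0,(nI(\theta_0))^{-1}}(\theta)+o(n^{-K/2})\frac{|nI(\theta_0)|^{1/2}}{1+\|\sqrt n I^{1/2}(\theta_0)(\theta-\theta_0)\|^{K+2}},$$ where $\theta$ is a dummy variable for values of $\hat\theta_n$, the $o(n^{-K/2})$ is uniform for $\theta$ in a compact set, and the Edgeworth polynomials are $$P_k(v)=\phi_d^{-1}(v)\sum_{q=1}^k\frac1{q!}\sum_{l_1+\cdots+l_q=k}\ \sum_{|r_m|=l_m+2,\,1\le m\le q}\frac{\chi_{r_1}\cdots\chi_{r_q}}{r_1!\cdots r_q!}(-1)^{|r_1|+\cdots+|r_q|}D^{r_1+\cdots+r_q}\phi_d(v),$$ with $\chi_r$ the $r$th cumulant ($r$ a multi-index).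
   Formalization: In (ii), P_k(Z) is corrected to P_k(-Z), h(n) is taken with |F| in place of F, and Assumption EE is required with the o(n^{-K/2}) uniform over all θ in Ω rather than only on compact sets; as printed, (ii) fails in each respect. *)

theory Defs
  imports "HOL-Probability.Probability" "HOL-Library.Landau_Symbols"
begin

section \<open>Multi-indices and iterated partial derivatives\<close>

text \<open>A multi-index on \<open>d\<close> coordinates is a function \<open>r :: 'd \<Rightarrow> nat\<close>.\<close>

definition mi_size :: "('d::finite \<Rightarrow> nat) \<Rightarrow> nat" where
  "mi_size r = (\<Sum>i\<in>UNIV. r i)"

definition mi_fact :: "('d::finite \<Rightarrow> nat) \<Rightarrow> real" where
  "mi_fact r = (\<Prod>i\<in>UNIV. fact (r i))"

definition mi_monom :: "('d::finite \<Rightarrow> nat) \<Rightarrow> real ^ 'd \<Rightarrow> real" where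
  "mi_monom r v = (\<Prod>i\<in>UNIV. (v $ i) ^ r i)"

definition partial_deriv ::
  "'d::finite \<Rightarrow> (real ^ 'd \<Rightarrow> 'b::real_normed_vector) \<Rightarrow> real ^ 'd \<Rightarrow> 'b" where
  "partial_deriv i f v = vector_derivative (\<lambda>s. f (v + s *\<^sub>R axis i 1)) (at 0)"

text \<open>The index type carries no order, so the coordinates are differentiated in the order of
  some fixed enumeration; for the smooth functions used below the order is immaterial.\<close>

definition mi_deriv ::
  "('d::finite \<Rightarrow> nat) \<Rightarrow> (real ^ 'd \<Rightarrow> 'b::real_normed_vector) \<Rightarrow> real ^ 'd \<Rightarrow> 'b" where
  "mi_deriv r = foldr (\<lambda>i. partial_deriv i ^^ r i) (SOME xs. distinct xs \<and> set xs = UNIV)"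

section \<open>Multivariate normal distributions and square roots\<close>

definition mvn_density :: "real ^ 'd \<Rightarrow> real ^ 'd ^ 'd \<Rightarrow> real ^ 'd::finite \<Rightarrow> real" where
  "mvn_density \<mu> \<Sigma> x =
     exp (- ((x - \<mu>) \<bullet> (matrix_inv \<Sigma> *v (x - \<mu>))) / 2) / sqrt ((2 * pi) ^ CARD('d) * det \<Sigma>)"

definition mvn :: "real ^ 'd \<Rightarrow> real ^ 'd ^ 'd \<Rightarrow> (real ^ 'd::finite) measure" where
  "mvn \<mu> \<Sigma> = density lborel (\<lambda>x. ennreal (mvn_density \<mu> \<Sigma> x))"

abbreviation std_mvn :: "(real ^ 'd::finite) measure" where
  "std_mvn \<equiv> mvn 0 (mat 1)"

abbreviation std_mvn_density :: "real ^ 'd::finite \<Rightarrow> real" where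
  "std_mvn_density \<equiv> mvn_density 0 (mat 1)"

text \<open>Distribution function; the order on vectors is componentwise.\<close>

definition mv_cdf :: "(real ^ 'd::finite) measure \<Rightarrow> real ^ 'd \<Rightarrow> real" where
  "mv_cdf M \<psi> = measure M {..\<psi>}"

definition is_pd_sqrt :: "real ^ 'd ^ 'd \<Rightarrow> real ^ 'd ^ 'd::finite \<Rightarrow> bool" where
  "is_pd_sqrt S A \<longleftrightarrow>
     transpose S = S \<and> (\<forall>v. v \<noteq> 0 \<longrightarrow> 0 < v \<bullet> (S *v v)) \<and> S ** S = A"

section \<open>The statistical model\<close>

text \<open>\<open>p \<theta>\<close> is the density of one observation with respect to a dominating measure \<open>\<nu>\<close>. A sample
  of size \<open>n\<close> is a function on \<open>{..<n}\<close>.\<close>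

definition model :: "'x measure \<Rightarrow> (real ^ 'd::finite \<Rightarrow> 'x \<Rightarrow> real) \<Rightarrow> real ^ 'd \<Rightarrow> 'x measure" where
  "model \<nu> p \<theta> = density \<nu> (\<lambda>x. ennreal (p \<theta> x))"

definition sample_law ::
  "'x measure \<Rightarrow> (real ^ 'd::finite \<Rightarrow> 'x \<Rightarrow> real) \<Rightarrow> real ^ 'd \<Rightarrow> nat \<Rightarrow> (nat \<Rightarrow> 'x) measure" where
  "sample_law \<nu> p \<theta> n = PiM {..<n} (\<lambda>_. model \<nu> p \<theta>)"

definition likelihood ::
  "(real ^ 'd::finite \<Rightarrow> 'x \<Rightarrow> real) \<Rightarrow> nat \<Rightarrow> (nat \<Rightarrow> 'x) \<Rightarrow> real ^ 'd \<Rightarrow> real" where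
  "likelihood p n xs \<theta> = (\<Prod>i<n. p \<theta> (xs i))"

definition posterior ::
  "(real ^ 'd::finite \<Rightarrow> 'x \<Rightarrow> real) \<Rightarrow> (real ^ 'd \<Rightarrow> real) \<Rightarrow> (real ^ 'd) set \<Rightarrow> nat \<Rightarrow> (nat \<Rightarrow> 'x)
     \<Rightarrow> (real ^ 'd) measure" where
  "posterior p w \<Omega> n xs =
     density lborel (\<lambda>\<theta>. ennreal (indicator \<Omega> \<theta> * w \<theta> * likelihood p n xs \<theta> /
       (LINT t:\<Omega>|lborel. w t * likelihood p n xs t)))"

definition is_mle ::
  "'x measure \<Rightarrow> (real ^ 'd::finite \<Rightarrow> 'x \<Rightarrow> real) \<Rightarrow> (real ^ 'd) set \<Rightarrow> real ^ 'd \<Rightarrow> nat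
     \<Rightarrow> ((nat \<Rightarrow> 'x) \<Rightarrow> real ^ 'd) \<Rightarrow> bool" where
  "is_mle \<nu> p \<Omega> \<theta>\<^sub>0 n T \<longleftrightarrow>
     T \<in> borel_measurable (sample_law \<nu> p \<theta>\<^sub>0 n) \<and>
     (AE xs in sample_law \<nu> p \<theta>\<^sub>0 n.
        T xs \<in> \<Omega> \<and> (\<forall>\<theta>\<in>\<Omega>. likelihood p n xs \<theta> \<le> likelihood p n xs (T xs)))"

definition score ::
  "(real ^ 'd::finite \<Rightarrow> 'x \<Rightarrow> real) \<Rightarrow> 'x \<Rightarrow> real ^ 'd \<Rightarrow> real ^ 'd" where
  "score p x \<theta> = (\<chi> i. partial_deriv i (\<lambda>t. ln (p t x)) \<theta>)"

definition hessian ::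
  "(real ^ 'd::finite \<Rightarrow> 'x \<Rightarrow> real) \<Rightarrow> 'x \<Rightarrow> real ^ 'd \<Rightarrow> real ^ 'd ^ 'd" where
  "hessian p x \<theta> = (\<chi> i j. partial_deriv i (partial_deriv j (\<lambda>t. ln (p t x))) \<theta>)"

definition fisher ::
  "'x measure \<Rightarrow> (real ^ 'd::finite \<Rightarrow> 'x \<Rightarrow> real) \<Rightarrow> real ^ 'd \<Rightarrow> real ^ 'd ^ 'd" where
  "fisher \<nu> p \<theta> = - (LINT x|model \<nu> p \<theta>. hessian p x \<theta>)"

text \<open>Since \<open>ennreal\<close> truncates at \<open>0\<close> and \<open>ln 0 = 0\<close>, the term \<open>ennreal (ln (p \<theta> x))\<close> is the positive
  part of \<open>log p(x|\<theta>)\<close>, also where \<open>p(x|\<theta>) = 0\<close>. The score has mean zero, so its covariance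
  matrix is the mean of its outer product.\<close>

locale regular_model =
  fixes \<nu> :: "'x measure" and p :: "real ^ 'd::finite \<Rightarrow> 'x \<Rightarrow> real"
    and w :: "real ^ 'd \<Rightarrow> real" and \<Omega> :: "(real ^ 'd) set" and \<theta>\<^sub>0 :: "real ^ 'd"
  assumes sigma_finite: "sigma_finite_measure \<nu>"
    and density_measurable: "\<And>\<theta>. \<theta> \<in> \<Omega> \<Longrightarrow> p \<theta> \<in> borel_measurable \<nu>"
    and density_nonneg: "\<And>\<theta> x. \<theta> \<in> \<Omega> \<Longrightarrow> x \<in> space \<nu> \<Longrightarrow> 0 \<le> p \<theta> x"
    and density_prob: "\<And>\<theta>. \<theta> \<in> \<Omega> \<Longrightarrow> prob_space (model \<nu> p \<theta>)"
    and closed_param: "closed \<Omega>"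
    and interior_param: "\<theta>\<^sub>0 \<in> interior \<Omega>"
    and identifiable: "inj_on (model \<nu> p) \<Omega>"
    and density_continuous: "\<And>x. x \<in> space \<nu> \<Longrightarrow> continuous_on \<Omega> (\<lambda>\<theta>. p \<theta> x)"
    and log_integrable: "integrable (model \<nu> p \<theta>\<^sub>0) (\<lambda>x. ln (p \<theta>\<^sub>0 x))"
    and local_sup: "\<And>\<theta>'. \<theta>' \<in> \<Omega> \<Longrightarrow> \<exists>\<rho>>0.
          (\<integral>\<^sup>+x. (SUP \<theta>\<in>{\<theta>\<in>\<Omega>. norm (\<theta> - \<theta>') < \<rho>}. ennreal (ln (p \<theta> x))) \<partial>model \<nu> p \<theta>\<^sub>0) < \<infinity>"
    and sup_at_infinity: "\<exists>R>0.
          (\<integral>\<^sup>+x. (SUP \<theta>\<in>{\<theta>\<in>\<Omega>. norm \<theta> > R}. ennreal (ln (p \<theta> x))) \<partial>model \<nu> p \<theta>\<^sub>0) < \<infinity>"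
    and vanishes_at_infinity:
          "\<And>x. x \<in> space \<nu> \<Longrightarrow> ((\<lambda>\<theta>. p \<theta> x) \<longlongrightarrow> 0) (inf at_infinity (principal \<Omega>))"
    and derivatives: "\<exists>\<delta>>0. \<exists>G. ball \<theta>\<^sub>0 \<delta> \<subseteq> \<Omega> \<and> integrable (model \<nu> p \<theta>\<^sub>0) G \<and>
          (AE x in model \<nu> p \<theta>\<^sub>0.
             (\<forall>\<theta>\<in>ball \<theta>\<^sub>0 \<delta>. 0 < p \<theta> x \<and> (\<lambda>t. ln (p t x)) differentiable (at \<theta>) \<and>
                (\<lambda>t. score p x t) differentiable (at \<theta>) \<and>
                norm (score p x \<theta>) \<le> G x \<and> norm (hessian p x \<theta>) \<le> G x) \<and>
             continuous_on (ball \<theta>\<^sub>0 \<delta>) (score p x) \<and> continuous_on (ball \<theta>\<^sub>0 \<delta>) (hessian p x))"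
    and score_integrable: "integrable (model \<nu> p \<theta>\<^sub>0) (\<lambda>x. score p x \<theta>\<^sub>0)"
    and score_mean: "(LINT x|model \<nu> p \<theta>\<^sub>0. score p x \<theta>\<^sub>0) = 0"
    and fisher_finite: "integrable (model \<nu> p \<theta>\<^sub>0) (\<lambda>x. hessian p x \<theta>\<^sub>0)"
    and fisher_pos_def: "\<And>v. v \<noteq> 0 \<Longrightarrow> 0 < v \<bullet> (fisher \<nu> p \<theta>\<^sub>0 *v v)"
    and score_square_integrable:
          "\<And>i j. integrable (model \<nu> p \<theta>\<^sub>0) (\<lambda>x. score p x \<theta>\<^sub>0 $ i * score p x \<theta>\<^sub>0 $ j)"
    and fisher_covariance: "fisher \<nu> p \<theta>\<^sub>0 =
          (\<chi> i j. LINT x|model \<nu> p \<theta>\<^sub>0. score p x \<theta>\<^sub>0 $ i * score p x \<theta>\<^sub>0 $ j)"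
    and prior_measurable: "w \<in> borel_measurable borel"
    and prior_nonneg: "\<And>\<theta>. \<theta> \<in> \<Omega> \<Longrightarrow> 0 \<le> w \<theta>"
    and prior_integrable: "set_integrable lborel \<Omega> w"
    and prior_prob: "(LINT \<theta>:\<Omega>|lborel. w \<theta>) = 1"
    and prior_continuous: "isCont w \<theta>\<^sub>0"
    and prior_positive: "0 < w \<theta>\<^sub>0"

section \<open>Normal approximations to the posterior\<close>

text \<open>\<open>approx_cov\<close> is \<open>(n I(\<theta>\<^sub>0))\<close> inverse.\<close>

definition approx_cov ::
  "'x measure \<Rightarrow> (real ^ 'd::finite \<Rightarrow> 'x \<Rightarrow> real) \<Rightarrow> real ^ 'd \<Rightarrow> nat \<Rightarrow> real ^ 'd ^ 'd" where
  "approx_cov \<nu> p \<theta>\<^sub>0 n = matrix_inv (real n *\<^sub>R fisher \<nu> p \<theta>\<^sub>0)"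

text \<open>The distribution written \<open>\<Phi>(z + \<surd>n I\<^sup>1\<^sup>/\<^sup>2(\<theta>\<^sub>0) (\<theta> - \<theta>\<^sub>0))\<close> as a function of \<open>\<theta>\<close>: the law of the
  \<open>\<theta>\<close> for which \<open>\<psi> = z + \<surd>n I\<^sup>1\<^sup>/\<^sup>2(\<theta>\<^sub>0) (\<theta> - \<theta>\<^sub>0)\<close> is standard normal. Its mean is \<open>\<theta>\<^sub>0\<close> \<^emph>\<open>minus\<close>
  \<open>(\<surd>n I\<^sup>1\<^sup>/\<^sup>2(\<theta>\<^sub>0))\<close> inverse applied to \<open>z\<close>.\<close>

definition shifted_normal ::
  "real ^ 'd ^ 'd \<Rightarrow> real ^ 'd \<Rightarrow> nat \<Rightarrow> real ^ 'd \<Rightarrow> (real ^ 'd::finite) measure" where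
  "shifted_normal I_half \<theta>\<^sub>0 n z =
     distr std_mvn borel (\<lambda>\<psi>. \<theta>\<^sub>0 + matrix_inv (sqrt (real n) *\<^sub>R I_half) *v (\<psi> - z))"

definition approx_error ::
  "'x measure \<Rightarrow> (real ^ 'd::finite \<Rightarrow> 'x \<Rightarrow> real) \<Rightarrow> (real ^ 'd \<Rightarrow> real) \<Rightarrow> (real ^ 'd) set \<Rightarrow> real ^ 'd
     \<Rightarrow> (nat \<Rightarrow> (nat \<Rightarrow> 'x) \<Rightarrow> real ^ 'd) \<Rightarrow> ((real ^ 'd) measure \<Rightarrow> real) \<Rightarrow> nat \<Rightarrow> (nat \<Rightarrow> 'x) \<Rightarrow> real" where
  "approx_error \<nu> p w \<Omega> \<theta>\<^sub>0 T F n xs =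
     F (posterior p w \<Omega> n xs) - F (mvn (T n xs) (approx_cov \<nu> p \<theta>\<^sub>0 n))"

section \<open>Johnson expandability of the posterior\<close>

definition standardized_posterior ::
  "(real ^ 'd::finite \<Rightarrow> 'x \<Rightarrow> real) \<Rightarrow> (real ^ 'd \<Rightarrow> real) \<Rightarrow> (real ^ 'd) set \<Rightarrow> real ^ 'd ^ 'd
     \<Rightarrow> (nat \<Rightarrow> (nat \<Rightarrow> 'x) \<Rightarrow> real ^ 'd) \<Rightarrow> nat \<Rightarrow> (nat \<Rightarrow> 'x) \<Rightarrow> (real ^ 'd) measure" where
  "standardized_posterior p w \<Omega> I_half T n xs =
     distr (posterior p w \<Omega> n xs) borel (\<lambda>\<theta>. sqrt (real n) *\<^sub>R (I_half *v (\<theta> - T n xs)))"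

text \<open>The coefficients \<open>a j r\<close> of the polynomial \<open>\<gamma>\<^sub>j\<close> are functions of the standardized posterior
  only.\<close>

definition johnson_expandable ::
  "'x measure \<Rightarrow> (real ^ 'd::finite \<Rightarrow> 'x \<Rightarrow> real) \<Rightarrow> (real ^ 'd \<Rightarrow> real) \<Rightarrow> (real ^ 'd) set \<Rightarrow> real ^ 'd
     \<Rightarrow> real ^ 'd ^ 'd \<Rightarrow> (nat \<Rightarrow> (nat \<Rightarrow> 'x) \<Rightarrow> real ^ 'd) \<Rightarrow> nat \<Rightarrow> bool" where
  "johnson_expandable \<nu> p w \<Omega> \<theta>\<^sub>0 I_half T J \<longleftrightarrow>
     (\<exists>(N::nat) (S :: nat \<Rightarrow> (nat \<Rightarrow> 'x) set) (C::real) (B::real) (m::nat)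
        (a :: nat \<Rightarrow> ('d \<Rightarrow> nat) \<Rightarrow> (real ^ 'd) measure \<Rightarrow> real).
        (\<forall>n. S n \<in> sets (sample_law \<nu> p \<theta>\<^sub>0 n)) \<and>
        (\<lambda>n. measure (sample_law \<nu> p \<theta>\<^sub>0 n) (space (sample_law \<nu> p \<theta>\<^sub>0 n) - S n)) \<longlonglongrightarrow> 0 \<and>
        0 < C \<and>
        (\<forall>n>N. \<forall>xs\<in>S n. let W\<^sub>o = standardized_posterior p w \<Omega> I_half T n xs in
           (\<forall>j\<in>{1..J}. \<forall>r. mi_size r \<le> m \<longrightarrow> \<bar>a j r W\<^sub>o\<bar> \<le> B) \<and>
           (\<forall>\<psi>. \<bar>mv_cdf W\<^sub>o \<psi> - mv_cdf std_mvn \<psi> -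
                  (\<Sum>j=1..J. real n powr (- real j / 2) * std_mvn_density \<psi> *
                     (\<Sum>r | mi_size r \<le> m. a j r W\<^sub>o * mi_monom r \<psi>))\<bar>
                \<le> C * real n powr (- (real J + 1) / 2))))"

section \<open>Edgeworth expansion of the density of the estimator\<close>

text \<open>Cumulants of a law \<open>\<kappa>\<close>: the derivatives at \<open>0\<close> of the logarithm of its characteristic function,
  divided by the power of the imaginary unit of order \<open>|r|\<close>.\<close>

definition cumulant :: "(real ^ 'd::finite) measure \<Rightarrow> ('d \<Rightarrow> nat) \<Rightarrow> real" where
  "cumulant \<kappa> r =
     Re (mi_deriv r (\<lambda>t. Ln (LINT y|\<kappa>. cis (t \<bullet> y))) 0 / \<i> ^ mi_size r)"

text \<open>The lists \<open>ls\<close> and \<open>rs\<close> are \<open>(l\<^sub>1, \<dots>, l\<^sub>q)\<close>, with positive entries, and \<open>(r\<^sub>1, \<dots>, r\<^sub>q)\<close>.\<close>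

definition edgeworth_poly :: "(real ^ 'd::finite) measure \<Rightarrow> nat \<Rightarrow> real ^ 'd \<Rightarrow> real" where
  "edgeworth_poly \<kappa> k v =
     (\<Sum>q=1..k. 1 / fact q *
        (\<Sum>ls | length ls = q \<and> (\<forall>l\<in>set ls. 1 \<le> l) \<and> sum_list ls = k.
         \<Sum>rs | list_all2 (\<lambda>r l. mi_size r = l + 2) rs ls.
           (\<Prod>r\<leftarrow>rs. cumulant \<kappa> r / mi_fact r) * (- 1) ^ (\<Sum>r\<leftarrow>rs. mi_size r) *
           mi_deriv (\<lambda>i. \<Sum>r\<leftarrow>rs. r i) std_mvn_density v))
     / std_mvn_density v"

text \<open>The expansion is required for \<open>\<theta>\<close> in \<open>\<Omega>\<close>, the set of values of the estimator, with a remainder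
  uniform in \<open>\<theta> \<in> \<Omega>\<close>. Uniformity on the compact subsets of an unbounded \<open>\<Omega>\<close> would not control the
  expectation of a functional of the estimator. The law \<open>\<kappa>\<close> is the one whose cumulants enter the
  polynomials.\<close>

definition edgeworth_expansion ::
  "'x measure \<Rightarrow> (real ^ 'd::finite \<Rightarrow> 'x \<Rightarrow> real) \<Rightarrow> (real ^ 'd) set \<Rightarrow> real ^ 'd
     \<Rightarrow> real ^ 'd ^ 'd \<Rightarrow> (nat \<Rightarrow> (nat \<Rightarrow> 'x) \<Rightarrow> real ^ 'd) \<Rightarrow> (real ^ 'd) measure \<Rightarrow> nat \<Rightarrow> bool" where
  "edgeworth_expansion \<nu> p \<Omega> \<theta>\<^sub>0 I_half T \<kappa> K \<longleftrightarrow>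
     (\<exists>(f :: nat \<Rightarrow> real ^ 'd \<Rightarrow> real) (e :: nat \<Rightarrow> real ^ 'd \<Rightarrow> real) (\<epsilon> :: nat \<Rightarrow> real).
        \<epsilon> \<in> o(\<lambda>n. real n powr (- real K / 2)) \<and>
        (\<forall>\<^sub>F n in sequentially.
           (\<forall>\<theta>. 0 \<le> f n \<theta>) \<and>
           distributed (sample_law \<nu> p \<theta>\<^sub>0 n) lborel (T n) (\<lambda>\<theta>. ennreal (f n \<theta>)) \<and>
           (\<forall>\<theta>\<in>\<Omega>. let v = sqrt (real n) *\<^sub>R (I_half *v (\<theta> - \<theta>\<^sub>0));
                        g = mvn_density \<theta>\<^sub>0 (approx_cov \<nu> p \<theta>\<^sub>0 n) \<theta> in
              f n \<theta> = g + (\<Sum>k=1..K. real n powr (- real k / 2) * edgeworth_poly \<kappa> k v * g)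
                     + e n \<theta> * sqrt (det (real n *\<^sub>R fisher \<nu> p \<theta>\<^sub>0)) / (1 + norm v ^ (K + 2)) \<and>
              \<bar>e n \<theta>\<bar> \<le> \<epsilon> n)))"

text \<open>Two points of care in the expansion of the expectation. The normal law centred at the value \<open>t\<close>
  of the estimator is \<open>shifted_normal I_half \<theta>\<^sub>0 n z\<close> with \<open>z = - v\<close>, where
  \<open>v = \<surd>n I\<^sup>1\<^sup>/\<^sup>2(\<theta>\<^sub>0) (t - \<theta>\<^sub>0)\<close> is the argument of the Edgeworth polynomials; in terms of \<open>z\<close> the
  latter are therefore evaluated at \<open>- z\<close>, that is, multiplied by the sign \<open>(-1)^k\<close>. The factor \<open>h\<close>
  bounds an integrated remainder only if \<open>F\<close> does not change sign, so in general it is taken for the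
  functional \<open>|F|\<close>; for nonnegative \<open>F\<close> this is \<open>h\<close> itself.\<close>

definition h_integrand ::
  "((real ^ 'd::finite) measure \<Rightarrow> real) \<Rightarrow> real ^ 'd ^ 'd \<Rightarrow> real ^ 'd \<Rightarrow> nat \<Rightarrow> nat \<Rightarrow> real ^ 'd \<Rightarrow> real" where
  "h_integrand F I_half \<theta>\<^sub>0 K n z = F (shifted_normal I_half \<theta>\<^sub>0 n z) / (1 + norm z ^ K)"

definition h_factor ::
  "((real ^ 'd::finite) measure \<Rightarrow> real) \<Rightarrow> real ^ 'd ^ 'd \<Rightarrow> real ^ 'd \<Rightarrow> nat \<Rightarrow> nat \<Rightarrow> real" where
  "h_factor F I_half \<theta>\<^sub>0 K n = (LINT z|lborel. h_integrand F I_half \<theta>\<^sub>0 K n z)"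

end

theory Submission
  imports Defs "HOL-Real_Asymp.Real_Asymp"
begin

text \<open>In part (i) the normal approximation contributes a constant. In part (ii) one integrates
  \<open>F(\<Phi>\<^sub>t)\<close>, where \<open>\<Phi>\<^sub>t\<close> is the normal law centred at \<open>t\<close>, against the density of the estimator and
  substitutes \<open>z = \<surd>n I\<^sup>1\<^sup>/\<^sup>2(\<theta>\<^sub>0) (\<theta>\<^sub>0 - t)\<close>. The density becomes the Gaussian expansion in \<open>- z\<close> up to an
  error at most \<open>\<eta>\<^sub>n / (1 + \<parallel>z\<parallel>\<^sup>K)\<close> with \<open>\<eta>\<^sub>n = o(n powr (- K / 2))\<close>, and integrating this error against \<open>F\<close>
  gives at most \<open>\<eta>\<^sub>n\<close> times the factor \<open>h(n)\<close> for \<open>|F|\<close>.\<close>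

section \<open>Lebesgue measure under affine maps\<close>

text \<open>\<open>F\<close> is an arbitrary functional, so nothing is known in advance about the
  map sending z to the value of \<open>F\<close> at
  \<open>shifted_normal I_half \<theta>\<^sub>0 n z\<close>. Its measurability can only be extracted
  from the integrability hypotheses. Cancellation in the error cannot be exploited either, so the
  error of the density expansion is bounded pointwise in absolute value; this is why |F| appears in
  the remainder. Every estimate is made at one fixed n and for almost every z. The passage to the
  limit concerns only the number \<open>\<eta> n\<close>, which collects two errors of different
  origin: the assumed Edgeworth remainder, valid on \<Omega>, and the part of the Gaussian expansion
  that lies off \<Omega>, where the estimator has no mass. The form of the Edgeworth terms matters
  only for the second error: being polynomials, they are beaten by the Gaussian factor together with
  any power of the norm of z.\<close>

lemma matrix_inv_eqI:
  fixes A B :: "real ^ 'n ^ 'n"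
  assumes "A ** B = mat 1"
  shows "matrix_inv A = B"
proof -
  have BA: "B ** A = mat 1"
    using assms by (simp add: matrix_left_right_inverse)
  with assms have "A ** matrix_inv A = mat 1"
    unfolding matrix_inv_def by (rule_tac someI2[of _ B]) auto
  have "matrix_inv A = (B ** A) ** matrix_inv A" by (simp add: BA)
  also have "\<dots> = B ** (A ** matrix_inv A)" by (simp only: matrix_mul_assoc)
  also have "\<dots> = B" by (simp add: \<open>A ** matrix_inv A = mat 1\<close>)
  finally show ?thesis .
qed

text \<open>The library has \<open>measure_linear_image\<close> only for well-ordered index types.\<close>

lemma measure_matrix_image:
  fixes A :: "real ^ 'n ^ 'n"
  assumes "S \<in> lmeasurable"
  shows "(*v) A ` S \<in> lmeasurable \<and> measure lebesgue ((*v) A ` S) = \<bar>det A\<bar> * measure lebesgue S"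
proof -
  let ?P = "\<lambda>A :: real ^ 'n ^ 'n. \<forall>S\<in>lmeasurable.
    (*v) A ` S \<in> lmeasurable \<and> measure lebesgue ((*v) A ` S) = \<bar>det A\<bar> * measure lebesgue S"
  \<comment> \<open>For determinant of modulus 1, preserving the volume of boxes already gives the
    claim for all measurable sets; the permutation and shear cases below use this reduction.\<close>
  have cboxes: "?P A"
    if "\<bar>det A\<bar> = 1" "\<And>a b. cbox a b \<noteq> {} \<Longrightarrow> measure lebesgue ((*v) A ` cbox a b) = measure lebesgue (cbox a b)"
    for A :: "real ^ 'n ^ 'n"
  proof
    fix S :: "(real ^ 'n) set" assume "S \<in> lmeasurable"
    moreover have "measure lebesgue ((*v) A ` cbox a b) = 1 * measure lebesgue (cbox a b)" for a b
      using that(2)[of a b] by (cases "cbox a b = {}") auto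
    ultimately show "(*v) A ` S \<in> lmeasurable \<and> measure lebesgue ((*v) A ` S) = \<bar>det A\<bar> * measure lebesgue S"
      using measure_linear_sufficient[of "(*v) A" S 1] that(1) by simp
  qed
  have "?P A"
  \<comment> \<open>Both properties pass to products of matrices, so it is enough to treat the
    generators: matrices with a zero row, diagonal ones, transpositions and shears.\<close>
  proof (induction A rule: induct_matrix_elementary_alt)
    case (1 A B)
    have "(*v) (A ** B) ` S = (*v) A ` (*v) B ` S" for S
      by (simp add: image_image matrix_vector_mul_assoc)
    with 1 show ?case by (simp add: det_mul abs_mult)
  next
    case (2 A i)
    have "negligible ((*v) A ` S)" for S
    proof (rule negligible_subset[OF negligible_standard_hyperplane_cart[of i]])
      show "(*v) A ` S \<subseteq> {x. x $ i = 0}"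
        using 2 by (auto simp: matrix_vector_mul_component row_def vec_lambda_eta)
    qed
    then show ?case
      using 2 by (simp add: det_zero_row negligible_iff_measure)
  next
    case (3 A)
    have "(\<Sum>j\<in>UNIV. A $ k $ j * x $ j) = (\<Sum>j\<in>UNIV. if j = k then A $ k $ k * x $ k else 0)" for k x
      using 3 by (intro sum.cong) auto
    then have "A *v x = (\<chi> k. A $ k $ k * x $ k)" for x
      by (simp add: vec_eq_iff matrix_vector_mult_def)
    moreover have "det A = (\<Prod>k\<in>UNIV. A $ k $ k)" using 3 by (rule det_diagonal)
    ultimately show ?case using measurable_stretch measure_stretch by auto
  next
    case (4 m n)
    let ?\<tau> = "Transposition.transpose m n"
    let ?A = "(\<chi> i j. mat 1 $ i $ ?\<tau> j) :: real ^ 'n ^ 'n"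
    have A: "?A *v x = (\<chi> i. x $ ?\<tau> i)" for x
    proof -
      have "(\<Sum>j\<in>UNIV. (if i = ?\<tau> j then 1 else 0) * x $ j) = (\<Sum>j\<in>UNIV. if j = ?\<tau> i then x $ j else 0)" for i
        by (intro sum.cong) auto
      then show ?thesis by (simp add: vec_eq_iff matrix_vector_mult_def mat_def)
    qed
    show ?case
    proof (rule cboxes)
      show "\<bar>det ?A\<bar> = 1"
        by (simp add: det_permute_columns permutes_swap_id sign_swap_id abs_mult)
      fix a b :: "real ^ 'n" assume ne: "cbox a b \<noteq> {}"
      have "(*v) ?A ` cbox a b = cbox (?A *v a) (?A *v b)"
      proof (intro set_eqI iffI)
        fix y assume "y \<in> cbox (?A *v a) (?A *v b)"
        then have "(\<chi> i. y $ ?\<tau> i) \<in> cbox a b"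
          by (auto simp: A mem_box_cart) (metis transpose_involutory)+
        moreover have "y = ?A *v (\<chi> i. y $ ?\<tau> i)" by (simp add: A vec_eq_iff)
        ultimately show "y \<in> (*v) ?A ` cbox a b" by blast
      qed (auto simp: A mem_box_cart)
      moreover from this ne have "cbox (?A *v a) (?A *v b) \<noteq> {}" by blast
      moreover have "(\<Prod>i\<in>UNIV. (b - a) $ ?\<tau> i) = (\<Prod>i\<in>UNIV. (b - a) $ i)"
        by (rule prod.permute[OF permutes_swap_id, where S = UNIV and g = "\<lambda>i. (b - a) $ i", unfolded o_def, symmetric]) auto
      ultimately show "measure lebesgue ((*v) ?A ` cbox a b) = measure lebesgue (cbox a b)"
        using ne by (simp add: content_cbox_cart A)
    qed
  next
    case (5 m n)
    let ?A = "(\<chi> i j. of_bool (i = m \<and> j = n \<or> i = j)) :: real ^ 'n ^ 'n"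
    have A: "?A *v x = (\<chi> i. if i = m then x $ m + x $ n else x $ i)" for x
    proof -
      have "(\<Sum>j\<in>UNIV. of_bool (i = m \<and> j = n \<or> i = j) * x $ j) =
          (\<Sum>j\<in>UNIV. (if j = i then x $ j else 0) + (if j = n then if i = m then x $ j else 0 else 0))" for i
        using 5 by (intro sum.cong) auto
      then show ?thesis
        by (auto simp: vec_eq_iff matrix_vector_mult_def sum.distrib)
    qed
    have "?A = (\<chi> k. if k = m then row m (mat 1) + 1 *s row n (mat 1) else row k (mat 1))"
      using 5 by (auto simp: vec_eq_iff row_def mat_def)
    then have "det ?A = det (mat 1 :: real ^ 'n ^ 'n)"
      using det_row_operation[OF 5, of "mat 1 :: real ^ 'n ^ 'n" 1] by simp
    then have det: "\<bar>det ?A\<bar> = 1" by simp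
    show ?case
    proof (rule cboxes[OF det])
      fix a b :: "real ^ 'n" assume ne: "cbox a b \<noteq> {}"
      \<comment> \<open>The formula for sheared boxes asks for a nonnegative lower corner in
        coordinate \<open>n\<close>. Translating the lower corner to \<open>0\<close> achieves this
        and changes no measure.\<close>
      have box: "cbox a b = (+) a ` cbox 0 (b - a)"
        by (simp add: cbox_translation[symmetric])
      have "(*v) ?A ` cbox a b = (+) (?A *v a) ` (*v) ?A ` cbox 0 (b - a)"
        unfolding box by (simp add: image_image matrix_vector_right_distrib)
      then have "measure lebesgue ((*v) ?A ` cbox a b) = measure lebesgue ((*v) ?A ` cbox 0 (b - a))"
        by (simp only: measure_translation)
      also have "\<dots> = measure lebesgue (cbox 0 (b - a))"
        unfolding A using ne box by (intro measure_shear_interval[OF 5]) auto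
      also have "\<dots> = measure lebesgue (cbox a b)"
        unfolding box by (simp only: measure_translation)
      finally show "measure lebesgue ((*v) ?A ` cbox a b) = measure lebesgue (cbox a b)" .
    qed
  qed
  with assms show ?thesis by blast
qed

text \<open>Reweighted by |det A|, the image measure gives every box its volume and is therefore
  \<open>lborel\<close> by uniqueness. Multiplying by |det B|, the reciprocal weight, recovers the
  image measure itself.\<close>

lemma distr_lborel_affine:
  fixes A B :: "real ^ 'n ^ 'n"
  assumes AB: "A ** B = mat 1"
  shows "distr lborel borel (\<lambda>x. c + A *v x) = density lborel (\<lambda>_. ennreal \<bar>det B\<bar>)"
proof -
  have BA: "B ** A = mat 1" using AB by (simp add: matrix_left_right_inverse)
  have det1: "\<bar>det A\<bar> * \<bar>det B\<bar> = 1"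
    using arg_cong[OF AB, of det] by (simp add: det_mul abs_mult[symmetric])
  have meas[measurable]: "(\<lambda>x. c + A *v x) \<in> borel_measurable borel"
    by (intro borel_measurable_continuous_onI continuous_intros)
  have "lborel = density (distr lborel borel (\<lambda>x. c + A *v x)) (\<lambda>_. ennreal \<bar>det A\<bar>)"
  proof (rule lborel_eqI)
    fix l u :: "real ^ 'n"
    assume lu: "\<And>b. b \<in> Basis \<Longrightarrow> l \<bullet> b \<le> u \<bullet> b"
    have pre: "(\<lambda>x. c + A *v x) -` box l u = (*v) B ` box (l - c) (u - c)"
    proof (intro set_eqI iffI)
      fix x assume "x \<in> (\<lambda>x. c + A *v x) -` box l u"
      then have "A *v x \<in> box (l - c) (u - c)"
        by (auto simp: mem_box inner_diff_left inner_add_left algebra_simps)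
      moreover have "x = B *v (A *v x)" using BA by (simp add: matrix_vector_mul_assoc)
      ultimately show "x \<in> (*v) B ` box (l - c) (u - c)" by blast
    next
      fix x assume "x \<in> (*v) B ` box (l - c) (u - c)"
      then obtain y where "y \<in> box (l - c) (u - c)" "x = B *v y" by blast
      then show "x \<in> (\<lambda>x. c + A *v x) -` box l u"
        using AB by (auto simp: matrix_vector_mul_assoc mem_box inner_diff_left inner_add_left algebra_simps)
    qed
    have lm: "(*v) B ` box (l - c) (u - c) \<in> lmeasurable"
      and mm: "measure lebesgue ((*v) B ` box (l - c) (u - c)) = \<bar>det B\<bar> * measure lebesgue (box (l - c) (u - c))"
      using measure_matrix_image[of "box (l - c) (u - c)" B] by auto
    \<comment> \<open>The image of the box is also the preimage of a box under the affine map, hence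
      Borel, so its Lebesgue measure computed above is its \<open>lborel\<close> measure.\<close>
    have bor: "(*v) B ` box (l - c) (u - c) \<in> sets borel"
      unfolding pre[symmetric] using measurable_sets[OF meas, of "box l u"] by simp
    have "emeasure lborel ((*v) B ` box (l - c) (u - c)) =
        ennreal (\<bar>det B\<bar> * measure lebesgue (box (l - c) (u - c)))"
      using bor emeasure_eq_measure2[OF lm] by (simp add: mm)
    also have "measure lebesgue (box (l - c) (u - c)) = (\<Prod>b\<in>Basis. (u - l) \<bullet> b)"
      using lu by (simp add: measure_lborel_box_eq inner_diff_left)
    finally have e: "emeasure lborel ((*v) B ` box (l - c) (u - c)) =
        ennreal (\<bar>det B\<bar> * (\<Prod>b\<in>Basis. (u - l) \<bullet> b))" .
    show "emeasure (density (distr lborel borel (\<lambda>x. c + A *v x)) (\<lambda>_. ennreal \<bar>det A\<bar>)) (box l u) =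
        (\<Prod>b\<in>Basis. (u - l) \<bullet> b)"
      using det1 by (simp add: emeasure_density_const emeasure_distr pre e ennreal_mult'[symmetric] mult.assoc[symmetric])
  qed simp
  from arg_cong[OF this, of "\<lambda>M. density M (\<lambda>_. ennreal \<bar>det B\<bar>)"]
  have "density lborel (\<lambda>_. ennreal \<bar>det B\<bar>) =
      density (distr lborel borel (\<lambda>x. c + A *v x)) (\<lambda>_. ennreal \<bar>det A\<bar> * ennreal \<bar>det B\<bar>)"
    by (subst (asm) density_density_eq) simp_all
  then show ?thesis
    using det1 by (simp add: ennreal_mult'[symmetric] density_1)
qed

lemma
  fixes A B :: "real ^ 'n ^ 'n" and H :: "real ^ 'n \<Rightarrow> real"
  assumes AB: "A ** B = mat 1" and [measurable]: "H \<in> borel_measurable borel"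
  shows integral_lborel_affine:
      "(LINT y|lborel. H y) = \<bar>det A\<bar> * (LINT x|lborel. H (c + A *v x))"
    and integrable_lborel_affine_iff:
      "integrable lborel (\<lambda>x. H (c + A *v x)) \<longleftrightarrow> integrable lborel H"
proof -
  have det1: "\<bar>det A\<bar> * \<bar>det B\<bar> = 1"
    using arg_cong[OF AB, of det] by (simp add: det_mul abs_mult[symmetric])
  have [measurable]: "(\<lambda>x. c + A *v x) \<in> borel_measurable borel"
    by (intro borel_measurable_continuous_onI continuous_intros)
  have "(LINT x|lborel. H (c + A *v x)) = (LINT y|density lborel (\<lambda>_. ennreal \<bar>det B\<bar>). H y)"
    by (simp add: integral_distr flip: distr_lborel_affine[OF AB, of c])
  also have "\<dots> = \<bar>det B\<bar> * (LINT y|lborel. H y)"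
    by (subst integral_density) auto
  finally show "(LINT y|lborel. H y) = \<bar>det A\<bar> * (LINT x|lborel. H (c + A *v x))"
    using det1 by (simp add: mult.assoc[symmetric])
  have "integrable lborel (\<lambda>x. H (c + A *v x)) \<longleftrightarrow>
      integrable (density lborel (\<lambda>_. ennreal \<bar>det B\<bar>)) H"
    by (simp add: integrable_distr_eq flip: distr_lborel_affine[OF AB, of c])
  also have "\<dots> \<longleftrightarrow> integrable lborel (\<lambda>x. \<bar>det B\<bar> * H x)"
    by (subst integrable_density) auto
  also have "\<dots> \<longleftrightarrow> integrable lborel H"
    using det1 by (subst integrable_mult_left_iff) auto
  finally show "integrable lborel (\<lambda>x. H (c + A *v x)) \<longleftrightarrow> integrable lborel H" .
qed

text \<open>The image measure is a multiple of \<open>lborel\<close>, so null sets pull back to null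
  sets. This carries the vanishing of the estimator's density off \<Omega> over to the standardized
  variable.\<close>

lemma AE_lborel_affine:
  fixes A B :: "real ^ 'n ^ 'n"
  assumes AB: "A ** B = mat 1" and P: "AE y in lborel. P y"
  shows "AE x in lborel. P (c + A *v x)"
proof -
  have [measurable]: "(\<lambda>x. c + A *v x) \<in> borel_measurable borel"
    by (intro borel_measurable_continuous_onI continuous_intros)
  have "AE y in distr lborel borel (\<lambda>x. c + A *v x). P y"
    unfolding distr_lborel_affine[OF AB] using P by (subst AE_density) auto
  then show ?thesis
    by (rule AE_distrD[rotated]) simp
qed

section \<open>Normal distributions and Edgeworth polynomials\<close>

lemma std_mvn_density_eq:
  "std_mvn_density (v :: real ^ 'd::finite) = exp (- (v \<bullet> v) / 2) / sqrt ((2 * pi) ^ CARD('d))"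
  by (simp add: mvn_density_def matrix_inv_eqI[of "mat 1" "mat 1"])

lemma std_mvn_density_pos: "0 < std_mvn_density v"
  by (simp add: std_mvn_density_eq)

lemma std_mvn_density_minus: "std_mvn_density (- v) = std_mvn_density v"
  by (simp add: std_mvn_density_eq)

lemma borel_measurable_std_mvn_density [measurable]:
  "std_mvn_density \<in> borel_measurable borel"
  unfolding std_mvn_density_eq
  by (intro borel_measurable_continuous_onI continuous_intros) simp_all

text \<open>\<open>B ** B\<close> is the precision matrix. Symmetry of \<open>B\<close> moves one
  factor across the inner product, which turns the quadratic form in the exponent into a squared
  norm.\<close>

lemma mvn_density_standardize:
  fixes B :: "real ^ 'd ^ 'd::finite"
  assumes sym: "transpose B = B" and inv: "B ** matrix_inv B = mat 1"
  shows "mvn_density t (matrix_inv (B ** B)) \<theta> = \<bar>det B\<bar> * std_mvn_density (B *v (\<theta> - t))"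
proof -
  let ?C = "matrix_inv B"
  have inv': "?C ** B = mat 1" using inv by (simp add: matrix_left_right_inverse)
  have "(B ** B) ** (?C ** ?C) = B ** (B ** ?C) ** ?C"
    by (simp only: matrix_mul_assoc)
  then have "(B ** B) ** (?C ** ?C) = mat 1"
    by (simp add: inv)
  then have 1: "matrix_inv (B ** B) = ?C ** ?C" by (rule matrix_inv_eqI)
  have "(?C ** ?C) ** (B ** B) = ?C ** (?C ** B) ** B"
    by (simp only: matrix_mul_assoc)
  then have "(?C ** ?C) ** (B ** B) = mat 1"
    by (simp add: inv')
  then have 2: "matrix_inv (?C ** ?C) = B ** B" by (rule matrix_inv_eqI)
  have det1: "det B * det ?C = 1" using arg_cong[OF inv, of det] by (simp add: det_mul)
  then have "det B \<noteq> 0" by auto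
  with det1 have detC: "det ?C = 1 / det B" by (simp add: field_simps)
  have 3: "(\<theta> - t) \<bullet> ((B ** B) *v (\<theta> - t)) = (B *v (\<theta> - t)) \<bullet> (B *v (\<theta> - t))"
    using transpose_matrix_vector[of B "\<theta> - t"]
    by (simp add: sym matrix_vector_mul_assoc[symmetric] dot_lmul_matrix[symmetric])
  show ?thesis
    unfolding std_mvn_density_eq unfolding mvn_density_def 1 2 3
    by (simp add: det_mul detC real_sqrt_divide real_sqrt_mult)
qed

text \<open>The two notations for the normal approximation meet here: the choice z =
  B(\<open>\<theta>\<^sub>0\<close> - t) cancels \<open>\<theta>\<^sub>0\<close> and leaves the mean
  t. Since z is minus the standardized value of t, this is the origin of the reflected argument
  \<open>- z\<close> in the Edgeworth polynomials.\<close>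

lemma shifted_normal_eq_mvn:
  fixes S :: "real ^ 'd ^ 'd::finite" and n :: nat
  defines "B \<equiv> sqrt (real n) *\<^sub>R S"
  assumes sym: "transpose B = B" and inv: "B ** matrix_inv B = mat 1"
  shows "shifted_normal S \<theta>\<^sub>0 n (B *v (\<theta>\<^sub>0 - t)) = mvn t (matrix_inv (B ** B))"
proof -
  let ?C = "matrix_inv B"
  have inv': "?C ** B = mat 1" using inv by (simp add: matrix_left_right_inverse)
  have [measurable]: "(\<lambda>x. t + ?C *v x) \<in> borel_measurable borel" "(\<lambda>x. B *v (x - t)) \<in> borel_measurable borel"
    by (intro borel_measurable_continuous_onI continuous_intros linear_continuous_on_compose[OF _ matrix_vector_mul_linear] | simp)+
  have centre: "\<theta>\<^sub>0 + ?C *v (\<psi> - B *v (\<theta>\<^sub>0 - t)) = t + ?C *v \<psi>" for \<psi>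
    by (simp add: matrix_vector_mult_diff_distrib matrix_vector_mul_assoc inv')
  \<comment> \<open>Used to write the standard normal density as a function of the image point, the
    form in which a density can be pulled through \<open>distr\<close>.\<close>
  have inverse_at: "B *v (t + ?C *v \<psi> - t) = \<psi>" for \<psi>
    by (simp add: matrix_vector_mul_assoc inv)
  have "shifted_normal S \<theta>\<^sub>0 n (B *v (\<theta>\<^sub>0 - t)) = distr std_mvn borel (\<lambda>\<psi>. t + ?C *v \<psi>)"
    unfolding shifted_normal_def B_def[symmetric] centre ..
  also have "\<dots> = distr (density lborel (\<lambda>\<psi>. ennreal (std_mvn_density (B *v (t + ?C *v \<psi> - t))))) borel
      (\<lambda>\<psi>. t + ?C *v \<psi>)"
    unfolding inverse_at by (simp add: mvn_def)
  also have "\<dots> = density (distr lborel borel (\<lambda>\<psi>. t + ?C *v \<psi>))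
      (\<lambda>\<theta>. ennreal (std_mvn_density (B *v (\<theta> - t))))"
    by (subst density_distr) auto
  also have "\<dots> = density lborel (\<lambda>\<theta>. ennreal \<bar>det B\<bar> * ennreal (std_mvn_density (B *v (\<theta> - t))))"
    unfolding distr_lborel_affine[OF inv'] by (subst density_density_eq) auto
  also have "\<dots> = mvn t (matrix_inv (B ** B))"
    by (simp add: mvn_def mvn_density_standardize[OF sym inv] ennreal_mult')
  finally show ?thesis .
qed

section \<open>Polynomials times the Gaussian density\<close>

lemma real_polynomial_function_directional_deriv:
  fixes q :: "'a::real_normed_vector \<Rightarrow> real"
  assumes "real_polynomial_function q"
  shows "\<exists>q'. real_polynomial_function q' \<and>
    (\<forall>v. ((\<lambda>s. q (v + s *\<^sub>R e)) has_real_derivative q' v) (at 0))"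
  using assms
proof (induction q rule: real_polynomial_function.induct)
  case (linear f)
  then interpret bounded_linear f .
  have "((\<lambda>s. f (v + s *\<^sub>R e)) has_real_derivative f e) (at 0)" for v
    unfolding add scaleR by (auto intro!: derivative_eq_intros)
  then show ?case by (intro exI[of _ "\<lambda>_. f e"]) auto
next
  case (const c)
  then show ?case by (intro exI[of _ "\<lambda>_. 0"]) auto
next
  case (add f g)
  then obtain f' g' where "real_polynomial_function f'" "real_polynomial_function g'"
    "\<And>v. ((\<lambda>s. f (v + s *\<^sub>R e)) has_real_derivative f' v) (at 0)"
    "\<And>v. ((\<lambda>s. g (v + s *\<^sub>R e)) has_real_derivative g' v) (at 0)" by blast
  then show ?case
    by (intro exI[of _ "\<lambda>v. f' v + g' v"]) (auto intro!: DERIV_add)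
next
  case (mult f g)
  then obtain f' g' where *: "real_polynomial_function f'" "real_polynomial_function g'"
    "\<And>v. ((\<lambda>s. f (v + s *\<^sub>R e)) has_real_derivative f' v) (at 0)"
    "\<And>v. ((\<lambda>s. g (v + s *\<^sub>R e)) has_real_derivative g' v) (at 0)" by blast
  have "((\<lambda>s. f (v + s *\<^sub>R e) * g (v + s *\<^sub>R e)) has_real_derivative f' v * g v + g' v * f v) (at 0)" for v
    using DERIV_mult[OF *(3)[of v] *(4)[of v]] by simp
  then show ?case using mult.hyps *(1,2)
    by (intro exI[of _ "\<lambda>v. f' v * g v + g' v * f v"]) auto
qed

text \<open>The partial derivative of the Gaussian density brings down the factor - v_i, so by the
  product rule the new polynomial is the derivative of \<open>q\<close> minus v_i times
  \<open>q\<close>. This is the recursion of the Hermite polynomials, up to sign.\<close>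

lemma partial_deriv_gaussian:
  fixes q :: "real ^ 'd::finite \<Rightarrow> real"
  assumes "real_polynomial_function q"
  shows "\<exists>q'. real_polynomial_function q' \<and>
    partial_deriv i (\<lambda>v. q v * std_mvn_density v) = (\<lambda>v. q' v * std_mvn_density v)"
proof -
  let ?e = "axis i 1 :: real ^ 'd"
  obtain q' where q': "real_polynomial_function q'"
    "\<And>v. ((\<lambda>s. q (v + s *\<^sub>R ?e)) has_real_derivative q' v) (at 0)"
    using real_polynomial_function_directional_deriv[OF assms] by blast
  have sq: "((\<lambda>s. (v + s *\<^sub>R ?e) \<bullet> (v + s *\<^sub>R ?e)) has_real_derivative 2 * (v $ i)) (at 0)" for v :: "real ^ 'd"
    by (auto intro!: derivative_eq_intros simp: inner_add_left inner_add_right inner_axis inner_commute)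
  have phi: "((\<lambda>s. std_mvn_density (v + s *\<^sub>R ?e)) has_real_derivative - (v $ i) * std_mvn_density v) (at 0)"
    for v :: "real ^ 'd"
  proof -
    have "((\<lambda>s. exp (- ((v + s *\<^sub>R ?e) \<bullet> (v + s *\<^sub>R ?e)) / 2)) has_real_derivative
        - (v $ i) * exp (- (v \<bullet> v) / 2)) (at 0)"
      by (rule derivative_eq_intros sq refl | simp)+
    from DERIV_cdivide[OF this] show ?thesis unfolding std_mvn_density_eq by simp
  qed
  have "((\<lambda>s. q (v + s *\<^sub>R ?e) * std_mvn_density (v + s *\<^sub>R ?e)) has_real_derivative
      (q' v - v $ i * q v) * std_mvn_density v) (at 0)" for v
    using DERIV_mult[OF q'(2)[of v] phi[of v]] by (simp add: algebra_simps)
  then have "partial_deriv i (\<lambda>v. q v * std_mvn_density v) =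
      (\<lambda>v. (q' v - v $ i * q v) * std_mvn_density v)"
    unfolding partial_deriv_def
    by (intro ext vector_derivative_at) (simp add: has_real_derivative_iff_has_vector_derivative)
  moreover have "real_polynomial_function (\<lambda>v. q' v - v $ i * q v)"
    by (intro real_polynomial_function_diff q'(1) real_polynomial_function.intros(4)
        [OF real_polynomial_function.intros(1)[OF bounded_linear_vec_nth] assms])
  ultimately show ?thesis by blast
qed

text \<open>The class of polynomials times the Gaussian density is stable under each partial
  derivative. The induction runs over an arbitrary list of coordinates, so it covers whichever
  enumeration \<open>mi_deriv\<close> has chosen.\<close>

lemma mi_deriv_gaussian:
  "\<exists>q. real_polynomial_function q \<and>
    mi_deriv r (std_mvn_density :: real ^ 'd::finite \<Rightarrow> real) = (\<lambda>v. q v * std_mvn_density v)"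
proof -
  let ?P = "\<lambda>f :: real ^ 'd \<Rightarrow> real. \<exists>q. real_polynomial_function q \<and> f = (\<lambda>v. q v * std_mvn_density v)"
  have step: "?P (partial_deriv i f)" if "?P f" for f i
    using that partial_deriv_gaussian by metis
  have "?P ((partial_deriv i ^^ k) f)" if "?P f" for f i k
    using that by (induction k) (auto intro: step)
  then have "?P (foldr (\<lambda>i. partial_deriv i ^^ r i) xs std_mvn_density)" for xs
  proof (induction xs)
    case Nil
    show ?case by (auto intro!: exI[of _ "\<lambda>_. 1"])
  qed simp
  then show ?thesis unfolding mi_deriv_def by blast
qed

text \<open>The division by the density moves inside the sums, where it cancels the Gaussian factor
  of each derivative.\<close>

lemma real_polynomial_function_edgeworth_poly:
  "real_polynomial_function (edgeworth_poly \<kappa> k :: real ^ 'd::finite \<Rightarrow> real)"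
proof -
  \<comment> \<open>An infinite index set gives the sum \<open>0\<close>, which is also a
    polynomial; this settles the sums over lists without counting them.\<close>
  have sum: "real_polynomial_function (\<lambda>v. \<Sum>i\<in>I. f i v)"
    if "\<And>i. real_polynomial_function (f i)" for I and f :: "'i \<Rightarrow> real ^ 'd \<Rightarrow> real"
    using that by (cases "finite I") auto
  have "real_polynomial_function (\<lambda>v :: real ^ 'd. mi_deriv r std_mvn_density v / std_mvn_density v)" for r
  proof -
    obtain q where q: "real_polynomial_function q"
      "mi_deriv r std_mvn_density = (\<lambda>v :: real ^ 'd. q v * std_mvn_density v)"
      using mi_deriv_gaussian by blast
    have "(\<lambda>v :: real ^ 'd. mi_deriv r std_mvn_density v / std_mvn_density v) = q"
      unfolding q(2) by (simp add: std_mvn_density_eq)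
    with q(1) show ?thesis by simp
  qed
  then have "real_polynomial_function (\<lambda>v :: real ^ 'd. \<Sum>q=1..k. 1 / fact q *
        (\<Sum>ls | length ls = q \<and> (\<forall>l\<in>set ls. 1 \<le> l) \<and> sum_list ls = k.
         \<Sum>rs | list_all2 (\<lambda>r l. mi_size r = l + 2) rs ls.
           (\<Prod>r\<leftarrow>rs. cumulant \<kappa> r / mi_fact r) * (- 1) ^ (\<Sum>r\<leftarrow>rs. mi_size r) *
           (mi_deriv (\<lambda>i. \<Sum>r\<leftarrow>rs. r i) std_mvn_density v / std_mvn_density v)))"
    by (intro sum real_polynomial_function.intros(4) real_polynomial_function.intros(2))
  also have "(\<lambda>v :: real ^ 'd. \<Sum>q=1..k. 1 / fact q *
        (\<Sum>ls | length ls = q \<and> (\<forall>l\<in>set ls. 1 \<le> l) \<and> sum_list ls = k.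
         \<Sum>rs | list_all2 (\<lambda>r l. mi_size r = l + 2) rs ls.
           (\<Prod>r\<leftarrow>rs. cumulant \<kappa> r / mi_fact r) * (- 1) ^ (\<Sum>r\<leftarrow>rs. mi_size r) *
           (mi_deriv (\<lambda>i. \<Sum>r\<leftarrow>rs. r i) std_mvn_density v / std_mvn_density v))) = edgeworth_poly \<kappa> k"
    by (intro ext) (simp only: edgeworth_poly_def sum_divide_distrib times_divide_eq_right[symmetric])
  finally show ?thesis .
qed

text \<open>The base \<open>1 + norm v\<close> is at least 1, so exponents may be enlarged freely:
  \<open>m + k\<close> serves for a sum as well as for a product.\<close>

lemma real_polynomial_function_growth:
  fixes q :: "'a::real_normed_vector \<Rightarrow> real"
  assumes "real_polynomial_function q"
  shows "\<exists>C m. 0 \<le> C \<and> (\<forall>v. \<bar>q v\<bar> \<le> C * (1 + norm v) ^ m)"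
  using assms
proof (induction q rule: real_polynomial_function.induct)
  case (linear f)
  then obtain K where K: "0 \<le> K" "\<And>v. norm (f v) \<le> norm v * K"
    using bounded_linear.nonneg_bounded by blast
  have "\<bar>f v\<bar> \<le> K * (1 + norm v) ^ 1" for v
    using K(2)[of v] K(1) by (simp add: algebra_simps)
  with K(1) show ?case by blast
next
  case (const c)
  show ?case by (intro exI[of _ "\<bar>c\<bar>"] exI[of _ 0]) auto
next
  case (add f g)
  then obtain C m D k where *: "0 \<le> C" "0 \<le> D"
    "\<And>v. \<bar>f v\<bar> \<le> C * (1 + norm v) ^ m" "\<And>v. \<bar>g v\<bar> \<le> D * (1 + norm v) ^ k" by metis
  have "\<bar>f v + g v\<bar> \<le> (C + D) * (1 + norm v) ^ (m + k)" for v
  proof -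
    have "(1 + norm v) ^ m \<le> (1 + norm v) ^ (m + k)" "(1 + norm v) ^ k \<le> (1 + norm v) ^ (m + k)"
      by (intro power_increasing; simp)+
    then have "C * (1 + norm v) ^ m \<le> C * (1 + norm v) ^ (m + k)"
      "D * (1 + norm v) ^ k \<le> D * (1 + norm v) ^ (m + k)"
      using *(1,2) by (auto intro: mult_left_mono)
    then show ?thesis using *(3,4)[of v] unfolding distrib_right by linarith
  qed
  with *(1,2) show ?case by (intro exI[of _ "C + D"] exI[of _ "m + k"]) auto
next
  case (mult f g)
  then obtain C m D k where *: "0 \<le> C" "0 \<le> D"
    "\<And>v. \<bar>f v\<bar> \<le> C * (1 + norm v) ^ m" "\<And>v. \<bar>g v\<bar> \<le> D * (1 + norm v) ^ k" by metis
  have "\<bar>f v * g v\<bar> \<le> (C * D) * (1 + norm v) ^ (m + k)" for v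
    using mult_mono[OF *(3)[of v] *(4)[of v]] *(1) by (simp add: abs_mult power_add mult_ac)
  with *(1,2) show ?case by (intro exI[of _ "C * D"] exI[of _ "m + k"]) auto
qed

text \<open>Only the norm of \<open>v\<close> enters, so this is a bound in one real variable: the
  limit at infinity controls the tail, and continuity on a compact interval the rest.\<close>

lemma gaussian_decay:
  "\<exists>C. \<forall>v :: real ^ 'd::finite. (1 + norm v) ^ m * std_mvn_density v \<le> C"
proof -
  define c where "c = sqrt ((2 * pi) ^ CARD('d))"
  have c: "0 < c" by (simp add: c_def)
  let ?g = "\<lambda>t :: real. (1 + t) ^ m * exp (- (t * t) / 2)"
  have "(?g \<longlongrightarrow> 0) at_top"
    by real_asymp
  then have "\<forall>\<^sub>F t in at_top. ?g t < 1"
    by (rule order_tendstoD) simp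
  then obtain R where R: "\<And>t. t \<ge> R \<Longrightarrow> ?g t < 1"
    unfolding eventually_at_top_linorder by blast
  have "continuous_on {0..R} ?g" by (intro continuous_intros) auto
  then have "bounded (?g ` {0..R})" by (intro compact_imp_bounded compact_continuous_image) auto
  then obtain M where M: "\<And>t. t \<in> {0..R} \<Longrightarrow> norm (?g t) \<le> M"
    unfolding bounded_iff by blast
  have g: "?g t \<le> max 1 M" if "0 \<le> t" for t
    using R[of t] M[of t] that by (cases "t \<ge> R") (auto simp: le_max_iff_disj abs_mult)
  have "(1 + norm v) ^ m * std_mvn_density v \<le> max 1 M / c" for v :: "real ^ 'd"
  proof -
    have "v \<bullet> v = norm v * norm v" by (simp add: dot_square_norm power2_eq_square)
    then have "(1 + norm v) ^ m * std_mvn_density v = ?g (norm v) / c"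
      by (simp add: std_mvn_density_eq c_def)
    also have "\<dots> \<le> max 1 M / c" using g[of "norm v"] c by (intro divide_right_mono) auto
    finally show ?thesis .
  qed
  then show ?thesis by blast
qed

lemma gaussian_poly_decay:
  fixes q :: "real ^ 'd::finite \<Rightarrow> real"
  assumes "real_polynomial_function q"
  shows "\<exists>C\<ge>0. \<forall>v. \<bar>q v\<bar> * (1 + norm v) ^ m * std_mvn_density v \<le> C"
proof -
  obtain C k where *: "0 \<le> C" "\<And>v. \<bar>q v\<bar> \<le> C * (1 + norm v) ^ k"
    using real_polynomial_function_growth[OF assms] by blast
  obtain D where D: "\<And>v :: real ^ 'd. (1 + norm v) ^ (k + m) * std_mvn_density v \<le> D"
    using gaussian_decay by blast
  have "\<bar>q v\<bar> * (1 + norm v) ^ m * std_mvn_density v \<le> C * D" for v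
  proof -
    have "\<bar>q v\<bar> * ((1 + norm v) ^ m * std_mvn_density v) \<le>
        C * (1 + norm v) ^ k * ((1 + norm v) ^ m * std_mvn_density v)"
      using *(2)[of v] std_mvn_density_pos[of v] by (intro mult_right_mono) auto
    also have "\<dots> = C * ((1 + norm v) ^ (k + m) * std_mvn_density v)" by (simp add: power_add mult_ac)
    also have "\<dots> \<le> C * D" using D[of v] *(1) by (intro mult_left_mono) auto
    finally show ?thesis by (simp add: mult_ac)
  qed
  moreover from this[of 0] have "0 \<le> C * D"
    using std_mvn_density_pos[of "0 :: real ^ 'd"]
    by (meson abs_ge_zero less_imp_le mult_nonneg_nonneg norm_ge_zero order_trans zero_le_power add_nonneg_nonneg zero_le_one)
  ultimately show ?thesis by blast
qed

section \<open>Expectation of a functional of the approximating normal distribution\<close>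

lemma
  fixes H :: "real ^ 'd::finite \<Rightarrow> real"
  assumes [measurable]: "H \<in> borel_measurable borel"
  shows integrable_std_mvn: "integrable std_mvn H \<longleftrightarrow> integrable lborel (\<lambda>z. std_mvn_density z * H z)"
    and integral_std_mvn: "(LINT z|std_mvn. H z) = (LINT z|lborel. std_mvn_density z * H z)"
proof -
  have "AE z in lborel. 0 \<le> std_mvn_density (z :: real ^ 'd)"
    by (intro AE_I2) (simp add: less_imp_le std_mvn_density_pos)
  then show "integrable std_mvn H \<longleftrightarrow> integrable lborel (\<lambda>z. std_mvn_density z * H z)"
    and "(LINT z|std_mvn. H z) = (LINT z|lborel. std_mvn_density z * H z)"
    unfolding mvn_def by (simp_all add: integrable_density integral_density)
qed

text \<open>Here \<open>h\<close> stands for the density of the standardized variable. Its distance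
  to the Gaussian expansion is known only in modulus, so integrating it against \<open>G\<close>
  puts |G| into the bound.\<close>

lemma gaussian_expansion_remainder:
  fixes G h :: "real ^ 'd::finite \<Rightarrow> real"
  assumes G: "integrable std_mvn G"
    and GQ: "\<And>k. k \<in> I \<Longrightarrow> integrable std_mvn (\<lambda>z. G z * Q k z)"
    and Gm: "integrable lborel (\<lambda>z. G z / (1 + norm z ^ m))"
    and hG: "integrable lborel (\<lambda>z. h z * G z)"
    and bound: "AE z in lborel.
      \<bar>h z - (1 + (\<Sum>k\<in>I. c k * Q k z)) * std_mvn_density z\<bar> \<le> \<eta> / (1 + norm z ^ m)"
  shows "\<bar>(LINT z|lborel. h z * G z) -
      ((LINT z|std_mvn. G z) + (\<Sum>k\<in>I. c k * (LINT z|std_mvn. G z * Q k z)))\<bar>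
    \<le> \<eta> * (LINT z|lborel. \<bar>G z\<bar> / (1 + norm z ^ m))"
proof -
  have sets: "sets (std_mvn :: (real ^ 'd) measure) = sets borel"
    by (simp add: mvn_def)
  \<comment> \<open>Integrability is the only source of measurability for \<open>G\<close> and its
    products with the \<open>Q k\<close>.\<close>
  have [measurable]: "G \<in> borel_measurable borel" "\<And>k. k \<in> I \<Longrightarrow> (\<lambda>z. G z * Q k z) \<in> borel_measurable borel"
    using borel_measurable_integrable[OF G] borel_measurable_integrable[OF GQ]
    by (simp_all add: measurable_cong_sets[OF sets refl])
  have iG: "integrable lborel (\<lambda>z. std_mvn_density z * G z)"
    using G by (simp add: integrable_std_mvn)
  have iGQ: "integrable lborel (\<lambda>z. c k * (std_mvn_density z * (G z * Q k z)))" if "k \<in> I" for k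
    using GQ[OF that] that by (simp add: integrable_std_mvn)
  let ?D = "\<lambda>z. h z - (1 + (\<Sum>k\<in>I. c k * Q k z)) * std_mvn_density z"
  have D: "?D z * G z = h z * G z - (std_mvn_density z * G z +
      (\<Sum>k\<in>I. c k * (std_mvn_density z * (G z * Q k z))))" for z
    by (simp add: algebra_simps sum_distrib_left sum_distrib_right)
  have iD: "integrable lborel (\<lambda>z. ?D z * G z)"
    unfolding D using hG iG iGQ by (intro Bochner_Integration.integrable_diff
        Bochner_Integration.integrable_add Bochner_Integration.integrable_sum)
  have "(LINT z|lborel. ?D z * G z) = (LINT z|lborel. h z * G z) - ((LINT z|lborel. std_mvn_density z * G z) +
      (\<Sum>k\<in>I. LINT z|lborel. c k * (std_mvn_density z * (G z * Q k z))))"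
    unfolding D using hG iG iGQ
    by (simp only: Bochner_Integration.integral_diff Bochner_Integration.integral_add
        Bochner_Integration.integral_sum Bochner_Integration.integrable_add Bochner_Integration.integrable_sum)
  also have "\<dots> = (LINT z|lborel. h z * G z) -
      ((LINT z|std_mvn. G z) + (\<Sum>k\<in>I. c k * (LINT z|std_mvn. G z * Q k z)))"
    by (simp add: integral_std_mvn cong: sum.cong)
  finally have "\<bar>(LINT z|lborel. h z * G z) -
      ((LINT z|std_mvn. G z) + (\<Sum>k\<in>I. c k * (LINT z|std_mvn. G z * Q k z)))\<bar> =
    \<bar>LINT z|lborel. ?D z * G z\<bar>" by simp
  also have "\<dots> \<le> (LINT z|lborel. \<bar>?D z * G z\<bar>)"
    by (rule integral_abs_bound)
  also have "\<dots> \<le> (LINT z|lborel. \<eta> * (\<bar>G z\<bar> / (1 + norm z ^ m)))"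
  proof (rule integral_mono_AE)
    show "integrable lborel (\<lambda>z. \<bar>?D z * G z\<bar>)" using iD by (rule integrable_abs)
    have "integrable lborel (\<lambda>z. \<bar>G z / (1 + norm z ^ m)\<bar>)" using Gm by (rule integrable_abs)
    then show "integrable lborel (\<lambda>z. \<eta> * (\<bar>G z\<bar> / (1 + norm z ^ m)))"
      by (intro integrable_mult_right) (simp add: abs_divide)
    show "AE z in lborel. \<bar>?D z * G z\<bar> \<le> \<eta> * (\<bar>G z\<bar> / (1 + norm z ^ m))"
      using bound
    proof eventually_elim
      case (elim z)
      have "\<bar>?D z\<bar> * \<bar>G z\<bar> \<le> \<eta> / (1 + norm z ^ m) * \<bar>G z\<bar>"
        using elim by (rule mult_right_mono) simp
      then show ?case by (simp add: abs_mult)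
    qed
  qed
  finally show ?thesis by (simp only: integral_mult_right_zero)
qed

text \<open>The expectation is an integral against \<open>f\<close>, and the substitution by
  \<open>\<theta>\<^sub>0\<close> minus the inverse of \<open>B\<close> applied to z has Jacobian 1
  / |det B|. Thus the quotient in \<open>bound\<close> is the density of
  B(\<open>\<theta>\<^sub>0\<close> - X), and \<open>F\<close> at the normal law centred at X
  becomes \<open>G\<close> at that variable.\<close>

lemma (in prob_space) normal_at_estimator_expansion:
  fixes S :: "real ^ 'd ^ 'd::finite" and n :: nat and X :: "'a \<Rightarrow> real ^ 'd"
    and F :: "(real ^ 'd) measure \<Rightarrow> real" and \<theta>\<^sub>0 :: "real ^ 'd"
  defines "B \<equiv> sqrt (real n) *\<^sub>R S"
  defines "G \<equiv> \<lambda>z. F (shifted_normal S \<theta>\<^sub>0 n z)"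
  assumes sym: "transpose B = B" and inv: "B ** matrix_inv B = mat 1"
    and f: "\<And>\<theta>. 0 \<le> f \<theta>" and X: "distributed M lborel X (\<lambda>\<theta>. ennreal (f \<theta>))"
    and FX: "integrable M (\<lambda>x. F (mvn (X x) (matrix_inv (B ** B))))"
    and G: "integrable std_mvn G"
    and GQ: "\<And>k. k \<in> I \<Longrightarrow> integrable std_mvn (\<lambda>z. G z * Q k z)"
    and Gm: "integrable lborel (\<lambda>z. G z / (1 + norm z ^ m))"
    and bound: "AE z in lborel. \<bar>f (\<theta>\<^sub>0 - matrix_inv B *v z) / \<bar>det B\<bar> -
      (1 + (\<Sum>k\<in>I. c k * Q k z)) * std_mvn_density z\<bar> \<le> \<eta> / (1 + norm z ^ m)"
  shows "\<bar>expectation (\<lambda>x. F (mvn (X x) (matrix_inv (B ** B)))) -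
      ((LINT z|std_mvn. G z) + (\<Sum>k\<in>I. c k * (LINT z|std_mvn. G z * Q k z)))\<bar>
    \<le> \<eta> * (LINT z|lborel. \<bar>G z\<bar> / (1 + norm z ^ m))"
proof -
  let ?C = "matrix_inv B"
  have inv': "?C ** B = mat 1" using inv by (simp add: matrix_left_right_inverse)
  then have AB: "(- ?C) ** (- B) = mat 1" by (simp add: matrix_matrix_mult_def vec_eq_iff)
  have neg: "\<theta>\<^sub>0 + (- ?C) *v z = \<theta>\<^sub>0 - ?C *v z" for z
    by (simp add: matrix_vector_mult_def vec_eq_iff sum_negf)
  have BC: "B *v (\<theta>\<^sub>0 - (\<theta>\<^sub>0 - ?C *v z)) = z" for z
    by (simp add: matrix_vector_mul_assoc inv)
  have det: "\<bar>det (- ?C)\<bar> = 1 / \<bar>det B\<bar>"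
  proof -
    \<comment> \<open>Comparing squares gives equal moduli without tracking the sign (-1)^d of the
      determinant.\<close>
    have "(- ?C) ** (- ?C) = ?C ** ?C" by (simp add: matrix_matrix_mult_def vec_eq_iff)
    then have "(det (- ?C))\<^sup>2 = (det ?C)\<^sup>2" by (metis det_mul power2_eq_square)
    then have "\<bar>det (- ?C)\<bar> = \<bar>det ?C\<bar>" by (simp add: power2_eq_iff abs_eq_iff)
    moreover have "\<bar>det B\<bar> * \<bar>det ?C\<bar> = 1"
      using arg_cong[OF inv, of det] by (simp add: det_mul abs_mult[symmetric])
    moreover from this have "\<bar>det B\<bar> \<noteq> 0" by auto
    ultimately show ?thesis by (simp add: field_simps)
  qed
  have F: "F (mvn t (matrix_inv (B ** B))) = G (B *v (\<theta>\<^sub>0 - t))" for t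
    unfolding G_def using shifted_normal_eq_mvn[of n S \<theta>\<^sub>0 t] sym inv by (simp add: B_def)
  have sets: "sets (std_mvn :: (real ^ 'd) measure) = sets borel"
    by (simp add: mvn_def)
  have G_meas[measurable]: "G \<in> borel_measurable borel"
    using borel_measurable_integrable[OF G] by (simp add: measurable_cong_sets[OF sets refl])
  have [measurable]: "(\<lambda>t. B *v (\<theta>\<^sub>0 - t)) \<in> borel_measurable borel"
    by (intro borel_measurable_continuous_onI continuous_intros
        linear_continuous_on_compose[OF _ matrix_vector_mul_linear])
  have [measurable]: "f \<in> borel_measurable borel"
    using distributed_real_measurable[OF _ X] f by simp
  have Gf: "f (\<theta>\<^sub>0 + (- ?C) *v z) * G (B *v (\<theta>\<^sub>0 - (\<theta>\<^sub>0 + (- ?C) *v z))) = f (\<theta>\<^sub>0 - ?C *v z) * G z" for z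
    unfolding neg BC ..
  have "integrable lborel (\<lambda>\<theta>. f \<theta> * G (B *v (\<theta>\<^sub>0 - \<theta>)))"
    using FX unfolding F by (subst distributed_integrable[OF X]) (use f in auto)
  then have "integrable lborel (\<lambda>z. f (\<theta>\<^sub>0 - ?C *v z) * G z)"
    by (subst (asm) integrable_lborel_affine_iff[OF AB, of _ \<theta>\<^sub>0, symmetric]) (simp_all only: Gf, measurable)
  then have hG: "integrable lborel (\<lambda>z. f (\<theta>\<^sub>0 - ?C *v z) / \<bar>det B\<bar> * G z)"
    using integrable_mult_right[of "1 / \<bar>det B\<bar>"] by fastforce
  have "expectation (\<lambda>x. F (mvn (X x) (matrix_inv (B ** B)))) = (LINT \<theta>|lborel. f \<theta> * G (B *v (\<theta>\<^sub>0 - \<theta>)))"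
    unfolding F by (subst distributed_integral[OF X]) (use f in auto)
  also have "\<dots> = 1 / \<bar>det B\<bar> * (LINT z|lborel. f (\<theta>\<^sub>0 - ?C *v z) * G z)"
    by (subst integral_lborel_affine[OF AB, of _ \<theta>\<^sub>0]) (simp_all only: Gf det, measurable)
  also have "\<dots> = (LINT z|lborel. f (\<theta>\<^sub>0 - ?C *v z) / \<bar>det B\<bar> * G z)"
    by (subst integral_mult_right_zero[symmetric]) simp
  finally show ?thesis
    using gaussian_expansion_remainder[OF G GQ Gm hG bound] by simp
qed

section \<open>The standardized Edgeworth expansion on and off the parameter set\<close>

text \<open>The bound must be uniform in the coefficients because they will be the powers n^(-k/2),
  which change with n. The weight \<open>1 + norm z ^ K\<close> is the one in h; the additional
  \<open>norm z ^ Suc K\<close> is later exchanged for a power of n.\<close>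

lemma gaussian_expansion_tail:
  fixes Q :: "'k \<Rightarrow> real ^ 'd::finite \<Rightarrow> real"
  assumes "finite I" and Q: "\<And>k. k \<in> I \<Longrightarrow> real_polynomial_function (Q k)"
  shows "\<exists>M\<ge>0. \<forall>c z. (\<forall>k\<in>I. \<bar>c k\<bar> \<le> 1) \<longrightarrow>
    \<bar>(1 + (\<Sum>k\<in>I. c k * Q k z)) * std_mvn_density z\<bar> * (1 + norm z ^ K) * norm z ^ Suc K \<le> M"
proof -
  \<comment> \<open>\<open>m\<close> is the total degree of the two weights. Their product is at
    most \<open>2 * (1 + norm z) ^ m\<close>, which accounts for the 2 in the final
    constant.\<close>
  define m where "m = K + Suc K"
  obtain D where D: "D \<ge> 0" "\<And>z :: real ^ 'd. \<bar>1\<bar> * (1 + norm z) ^ m * std_mvn_density z \<le> D"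
    using gaussian_poly_decay[OF real_polynomial_function.intros(2)[of 1], of m] by blast
  have "\<exists>C\<ge>0. \<forall>z. \<bar>Q k z\<bar> * (1 + norm z) ^ m * std_mvn_density z \<le> C" if "k \<in> I" for k
    by (rule gaussian_poly_decay[OF Q[OF that]])
  then obtain C where C: "\<And>k. k \<in> I \<Longrightarrow> 0 \<le> C k"
    "\<And>k z. k \<in> I \<Longrightarrow> \<bar>Q k z\<bar> * (1 + norm z) ^ m * std_mvn_density z \<le> C k" by metis
  have "\<bar>(1 + (\<Sum>k\<in>I. c k * Q k z)) * std_mvn_density z\<bar> * (1 + norm z ^ K) * norm z ^ Suc K
      \<le> 2 * (D + sum C I)"
    if c: "\<forall>k\<in>I. \<bar>c k\<bar> \<le> 1" for c z
  proof -
    let ?N = "(1 + norm z) ^ m * std_mvn_density z"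
    have N: "0 \<le> ?N" using std_mvn_density_pos[of z] by simp
    have "norm z ^ K \<le> (1 + norm z) ^ K" "1 \<le> (1 + norm z) ^ K"
      by (auto intro!: power_mono one_le_power)
    then have "1 + norm z ^ K \<le> 2 * (1 + norm z) ^ K" by linarith
    moreover have "norm z ^ Suc K \<le> (1 + norm z) ^ Suc K"
      by (intro power_mono) auto
    ultimately have "(1 + norm z ^ K) * norm z ^ Suc K \<le> (2 * (1 + norm z) ^ K) * (1 + norm z) ^ Suc K"
      by (rule mult_mono) auto
    then have pow: "(1 + norm z ^ K) * norm z ^ Suc K \<le> 2 * (1 + norm z) ^ m"
      by (simp only: m_def power_add mult.assoc)
    have "\<bar>1 + (\<Sum>k\<in>I. c k * Q k z)\<bar> \<le> 1 + (\<Sum>k\<in>I. \<bar>c k * Q k z\<bar>)"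
      using sum_abs[of "\<lambda>k. c k * Q k z" I] by linarith
    also have "\<dots> \<le> 1 + (\<Sum>k\<in>I. \<bar>Q k z\<bar>)"
      using c by (intro add_left_mono sum_mono) (auto simp: abs_mult intro: mult_left_le_one_le)
    finally have "\<bar>1 + (\<Sum>k\<in>I. c k * Q k z)\<bar> * ?N \<le> (1 + (\<Sum>k\<in>I. \<bar>Q k z\<bar>)) * ?N"
      using N by (rule mult_right_mono)
    also have "\<dots> = ?N + (\<Sum>k\<in>I. \<bar>Q k z\<bar> * (1 + norm z) ^ m * std_mvn_density z)"
      by (simp add: distrib_right sum_distrib_right mult.assoc)
    also have "\<dots> \<le> D + sum C I"
      using D(2)[of z] C(2)[of _ z] by (intro add_mono sum_mono) auto
    finally have main: "\<bar>1 + (\<Sum>k\<in>I. c k * Q k z)\<bar> * ?N \<le> D + sum C I" .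
    have "\<bar>(1 + (\<Sum>k\<in>I. c k * Q k z)) * std_mvn_density z\<bar> * ((1 + norm z ^ K) * norm z ^ Suc K)
        \<le> \<bar>(1 + (\<Sum>k\<in>I. c k * Q k z)) * std_mvn_density z\<bar> * (2 * (1 + norm z) ^ m)"
      by (rule mult_left_mono[OF pow]) simp
    also have "\<dots> = 2 * (\<bar>1 + (\<Sum>k\<in>I. c k * Q k z)\<bar> * ?N)"
      using std_mvn_density_pos[of z] by (simp add: abs_mult mult_ac)
    also have "\<dots> \<le> 2 * (D + sum C I)" using main by simp
    finally show ?thesis by (simp only: mult.assoc)
  qed
  moreover have "0 \<le> 2 * (D + sum C I)" using D(1) C(1) by (simp add: sum_nonneg)
  ultimately show ?thesis by blast
qed

text \<open>Positive definiteness makes the kernel of \<open>S\<close> trivial, hence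
  \<open>S\<close> invertible, and \<open>n\<close> at least 1 keeps the scaling factor
  nonzero.\<close>

lemma is_pd_sqrt_scaled:
  fixes S A :: "real ^ 'd ^ 'd::finite" and n :: nat
  defines "B \<equiv> sqrt (real n) *\<^sub>R S"
  assumes S: "is_pd_sqrt S A" and n: "1 \<le> n"
  shows "transpose B = B" and "B ** B = real n *\<^sub>R A" and "B ** matrix_inv B = mat 1"
    and "matrix_inv B = (1 / sqrt (real n)) *\<^sub>R matrix_inv S"
proof -
  show "transpose B = B" using S by (simp add: B_def is_pd_sqrt_def transpose_scalar)
  show "B ** B = real n *\<^sub>R A"
    using S by (simp add: B_def is_pd_sqrt_def matrix_scalar_ac scalar_matrix_assoc[symmetric])
  have "\<forall>v. S *v v = 0 \<longrightarrow> v = 0"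
    using S unfolding is_pd_sqrt_def by (metis inner_zero_right less_irrefl)
  then obtain S' where "S' ** S = mat 1" unfolding matrix_left_invertible_ker[symmetric] by blast
  then have S': "S ** S' = mat 1" by (simp add: matrix_left_right_inverse)
  then have eq: "matrix_inv S = S'" by (rule matrix_inv_eqI)
  have BS: "B ** ((1 / sqrt (real n)) *\<^sub>R S') = mat 1"
    using n S' by (simp add: B_def matrix_scalar_ac scalar_matrix_assoc[symmetric])
  then have "matrix_inv B = (1 / sqrt (real n)) *\<^sub>R S'" by (rule matrix_inv_eqI)
  with BS eq show "B ** matrix_inv B = mat 1" "matrix_inv B = (1 / sqrt (real n)) *\<^sub>R matrix_inv S"
    by simp_all
qed

lemma prob_space_sample_law:
  assumes "regular_model \<nu> p w \<Omega> \<theta>\<^sub>0"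
  shows "prob_space (sample_law \<nu> p \<theta>\<^sub>0 n)"
proof -
  interpret regular_model \<nu> p w \<Omega> \<theta>\<^sub>0 by fact
  have "\<theta>\<^sub>0 \<in> \<Omega>" using interior_param interior_subset by blast
  then show ?thesis unfolding sample_law_def by (intro prob_space_PiM density_prob)
qed

text \<open>The expansion of \<open>f\<close> is available on \<open>\<Omega>\<close> only. Off \<open>\<Omega>\<close> the density \<open>f\<close> vanishes, but the Gaussian
  expansion does not; there \<open>\<delta> \<surd>n \<le> L \<parallel>z\<parallel>\<close>, so Gaussian decay makes its contribution
  \<open>O(n powr (- (K + 1) / 2))\<close>.\<close>

lemma edgeworth_density_bound:
  fixes \<Omega> :: "(real ^ 'd::finite) set" and f :: "real ^ 'd \<Rightarrow> real" and Q :: "nat \<Rightarrow> real ^ 'd \<Rightarrow> real"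
  assumes S: "is_pd_sqrt S A" and n: "1 \<le> n"
    and L: "0 < L" "\<And>z. norm (matrix_inv S *v z) \<le> L * norm z"
    and \<delta>: "0 < \<delta>" "ball \<theta>\<^sub>0 \<delta> \<subseteq> \<Omega>"
    and M: "0 \<le> M" "\<And>z. \<bar>(1 + (\<Sum>k=1..K. c k * Q k (- z))) * std_mvn_density z\<bar> *
        (1 + norm z ^ K) * norm z ^ Suc K \<le> M"
    and outside: "AE \<theta> in lborel. \<theta> \<notin> \<Omega> \<longrightarrow> f \<theta> = 0"
    and inside: "\<And>\<theta>. \<theta> \<in> \<Omega> \<Longrightarrow>
      \<bar>f \<theta> - (1 + (\<Sum>k=1..K. c k * Q k (sqrt (real n) *\<^sub>R (S *v (\<theta> - \<theta>\<^sub>0))))) *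
          mvn_density \<theta>\<^sub>0 (matrix_inv (real n *\<^sub>R A)) \<theta>\<bar>
        \<le> \<epsilon> * sqrt (det (real n *\<^sub>R A)) / (1 + norm (sqrt (real n) *\<^sub>R (S *v (\<theta> - \<theta>\<^sub>0))) ^ (K + 2))"
    and \<epsilon>: "0 \<le> \<epsilon>"
  shows "AE z in lborel.
      \<bar>f (\<theta>\<^sub>0 - matrix_inv (sqrt (real n) *\<^sub>R S) *v z) / \<bar>det (sqrt (real n) *\<^sub>R S)\<bar> -
        (1 + (\<Sum>k=1..K. c k * Q k (- z))) * std_mvn_density z\<bar>
      \<le> (2 * \<epsilon> + M * (L / \<delta>) ^ Suc K * real n powr (- (real K + 1) / 2)) / (1 + norm z ^ K)"
proof -
  define B where "B = sqrt (real n) *\<^sub>R S"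
  let ?C = "matrix_inv B"
  let ?r = "real n powr (- (real K + 1) / 2)"
  note B = is_pd_sqrt_scaled[OF S n, folded B_def]
  have CB: "?C ** B = mat 1" using B(3) by (simp add: matrix_left_right_inverse)
  have AB: "(- ?C) ** (- B) = mat 1" using CB by (simp add: matrix_matrix_mult_def vec_eq_iff)
  have neg: "\<theta>\<^sub>0 + (- ?C) *v z = \<theta>\<^sub>0 - ?C *v z" for z
    by (simp add: matrix_vector_mult_def vec_eq_iff sum_negf)
  have "det B * det ?C = 1" using arg_cong[OF B(3), of det] by (simp add: det_mul)
  then have detB: "0 < \<bar>det B\<bar>" by auto
  \<comment> \<open>The substitution reverses direction, so the Edgeworth polynomials receive
    \<open>- z\<close>; the Gaussian density is even and can keep \<open>z\<close>.\<close>
  have Bz: "B *v (\<theta>\<^sub>0 - ?C *v z - \<theta>\<^sub>0) = - z" for z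
  proof -
    have "B *v (\<theta>\<^sub>0 - ?C *v z - \<theta>\<^sub>0) = - (B *v (?C *v z))"
      by (simp add: matrix_vector_mult_def vec_eq_iff sum_negf)
    then show ?thesis by (simp add: matrix_vector_mul_assoc B(3))
  qed
  then have v: "sqrt (real n) *\<^sub>R (S *v (\<theta>\<^sub>0 - ?C *v z - \<theta>\<^sub>0)) = - z" for z
    by (simp only: B_def scaleR_matrix_vector_assoc)
  have g: "mvn_density \<theta>\<^sub>0 (matrix_inv (real n *\<^sub>R A)) (\<theta>\<^sub>0 - ?C *v z) = \<bar>det B\<bar> * std_mvn_density z" for z
    unfolding B(2)[symmetric] mvn_density_standardize[OF B(1,3)] Bz std_mvn_density_minus ..
  have sqrt_det: "sqrt (det (real n *\<^sub>R A)) = \<bar>det B\<bar>"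
    unfolding B(2)[symmetric] by (simp add: det_mul)
  \<comment> \<open>The density \<open>f\<close> is determined only up to null sets, so its
    vanishing off \<Omega>, and with it the final bound, holds only almost everywhere.\<close>
  have "AE z in lborel. \<theta>\<^sub>0 - ?C *v z \<notin> \<Omega> \<longrightarrow> f (\<theta>\<^sub>0 - ?C *v z) = 0"
    using AE_lborel_affine[OF AB outside, of \<theta>\<^sub>0] unfolding neg .
  then show ?thesis unfolding B_def[symmetric]
  proof eventually_elim
    case (elim z)
    let ?\<theta> = "\<theta>\<^sub>0 - ?C *v z" and ?q = "(1 + (\<Sum>k=1..K. c k * Q k (- z))) * std_mvn_density z"
    show ?case
    proof (cases "?\<theta> \<in> \<Omega>")
      case True
      have "f ?\<theta> / \<bar>det B\<bar> - ?q = (f ?\<theta> - (1 + (\<Sum>k=1..K. c k * Q k (- z))) * (\<bar>det B\<bar> * std_mvn_density z)) / \<bar>det B\<bar>"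
        using detB by (simp add: field_simps)
      then have "\<bar>f ?\<theta> / \<bar>det B\<bar> - ?q\<bar> =
          \<bar>f ?\<theta> - (1 + (\<Sum>k=1..K. c k * Q k (- z))) * (\<bar>det B\<bar> * std_mvn_density z)\<bar> / \<bar>det B\<bar>"
        by (simp add: abs_divide)
      also have "\<dots> \<le> (\<epsilon> * \<bar>det B\<bar> / (1 + norm z ^ (K + 2))) / \<bar>det B\<bar>"
        using inside[OF True] detB unfolding v g sqrt_det by (intro divide_right_mono) auto
      also have "\<dots> = \<epsilon> * (1 / (1 + norm z ^ (K + 2)))"
        using detB by simp
      also have "\<dots> \<le> \<epsilon> * (2 / (1 + norm z ^ K))"
      proof (rule mult_left_mono[OF _ \<epsilon>])
        have double: "1 + a \<le> 2 * (1 + b)" if "a \<le> 1 + b" "0 \<le> b" for a b :: real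
          by (rule order_trans[OF add_left_mono[OF that(1)]]) (use that(2) in simp)
        \<comment> \<open>If the norm is at most 1 the left side is at most 1; otherwise powers
          increase with the exponent. Lowering the weight from K + 2 to K therefore costs the factor
          2 in front of \<epsilon>.\<close>
        have "norm z ^ K \<le> 1 + norm z ^ (K + 2)"
        proof (cases "norm z \<le> 1")
          case True
          then have "norm z ^ K \<le> 1" by (simp add: power_le_one)
          then show ?thesis by (simp add: add_increasing2)
        next
          case False
          then have "norm z ^ K \<le> norm z ^ (K + 2)" by (intro power_increasing) auto
          then show ?thesis by simp
        qed
        then have "1 + norm z ^ K \<le> 2 * (1 + norm z ^ (K + 2))" by (rule double) simp
        moreover have "0 < 1 + norm z ^ K" "0 < 1 + norm z ^ (K + 2)"
          by (auto intro: add_pos_nonneg)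
        ultimately show "1 / (1 + norm z ^ (K + 2)) \<le> 2 / (1 + norm z ^ K)"
          by (simp add: divide_simps del: power_Suc)
      qed
      also have "\<dots> \<le> (2 * \<epsilon> + M * (L / \<delta>) ^ Suc K * ?r) / (1 + norm z ^ K)"
        using M(1) L(1) \<delta>(1) by (simp add: divide_right_mono)
      finally show ?thesis .
    next
      case False
      have "?\<theta> \<notin> ball \<theta>\<^sub>0 \<delta>" using False \<delta>(2) by blast
      then have "\<delta> \<le> norm (?C *v z)" by (simp add: dist_norm)
      also have "\<dots> = norm (matrix_inv S *v z) / sqrt (real n)"
        by (simp add: B(4) scaleR_matrix_vector_assoc[symmetric])
      also have "\<dots> \<le> L * norm z / sqrt (real n)"
        using L(2) by (intro divide_right_mono) auto
      finally have "sqrt (real n) \<le> (L / \<delta>) * norm z"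
        using n \<delta>(1) by (simp add: field_simps)
      then have "sqrt (real n) ^ Suc K \<le> ((L / \<delta>) * norm z) ^ Suc K"
        by (intro power_mono) auto
      then have z: "sqrt (real n) ^ Suc K \<le> (L / \<delta>) ^ Suc K * norm z ^ Suc K"
        by (simp only: power_mult_distrib)
      \<comment> \<open>This factor 1 is inserted below. Its power of sqrt n is replaced, by
        \<open>z\<close>, with the power \<open>Suc K\<close> of the norm that \<open>M\<close>
        absorbs, and the rate \<open>?r\<close> stays behind.\<close>
      have r: "?r * sqrt (real n) ^ Suc K = 1"
      proof -
        have "sqrt (real n) ^ Suc K = real n powr ((real K + 1) / 2)"
          using n by (simp add: powr_half_sqrt[symmetric] powr_realpow[symmetric] powr_powr add.commute del: power_Suc)
        then have "?r * sqrt (real n) ^ Suc K = real n powr (- (real K + 1) / 2 + (real K + 1) / 2)"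
          by (simp only: powr_add)
        also have "- (real K + 1) / 2 + (real K + 1) / 2 = 0" by (simp add: field_simps)
        finally show ?thesis using n by simp
      qed
      have "\<bar>?q\<bar> * (1 + norm z ^ K) = \<bar>?q\<bar> * (1 + norm z ^ K) * (?r * sqrt (real n) ^ Suc K)"
        unfolding r by simp
      also have "\<dots> = ?r * (\<bar>?q\<bar> * (1 + norm z ^ K)) * sqrt (real n) ^ Suc K"
        by (simp only: mult_ac)
      also have "\<dots> \<le> ?r * (\<bar>?q\<bar> * (1 + norm z ^ K)) * ((L / \<delta>) ^ Suc K * norm z ^ Suc K)"
        by (rule mult_left_mono[OF z]) simp
      also have "\<dots> = ?r * (L / \<delta>) ^ Suc K * (\<bar>?q\<bar> * (1 + norm z ^ K) * norm z ^ Suc K)"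
        by (simp only: mult_ac)
      also have "\<dots> \<le> ?r * (L / \<delta>) ^ Suc K * M"
        using L(1) \<delta>(1) by (intro mult_left_mono[OF M(2)]) simp
      also have "\<dots> \<le> 2 * \<epsilon> + M * (L / \<delta>) ^ Suc K * ?r"
        using \<epsilon> by (simp add: mult_ac)
      finally have "\<bar>?q\<bar> \<le> (2 * \<epsilon> + M * (L / \<delta>) ^ Suc K * ?r) / (1 + norm z ^ K)"
        by (subst pos_le_divide_eq) (auto intro: add_pos_nonneg)
      then show ?thesis using elim False by simp
    qed
  qed
qed

text \<open>The estimates yield an inequality, whereas the expansion is an equation with a small-o
  factor; the quotient of the error by \<open>h\<close> is that factor.\<close>

lemma smallo_factor:
  fixes D h \<eta> :: "nat \<Rightarrow> real"
  assumes bound: "\<forall>\<^sub>F n in sequentially. \<bar>D n\<bar> \<le> \<eta> n * h n \<and> 0 \<le> h n \<and> 0 \<le> \<eta> n"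
    and \<eta>: "\<eta> \<in> o(g)"
  shows "\<exists>\<rho>. \<rho> \<in> o(g) \<and> (\<forall>\<^sub>F n in sequentially. D n = \<rho> n * h n)"
proof (intro exI conjI)
  \<comment> \<open>Where \<open>h n = 0\<close> the bound forces \<open>D n = 0\<close>, so the junk value \<open>0 / 0 = 0\<close> is right.\<close>
  let ?\<rho> = "\<lambda>n. D n / h n"
  have "\<forall>\<^sub>F n in sequentially. norm (?\<rho> n) \<le> 1 * norm (\<eta> n)"
    using bound
  proof eventually_elim
    case (elim n)
    then show ?case by (cases "h n = 0") (auto simp: abs_divide divide_simps)
  qed
  then have "?\<rho> \<in> O(\<eta>)" by (rule bigoI)
  then show "?\<rho> \<in> o(g)" using \<eta> by (rule landau_o.big_small_trans)
  show "\<forall>\<^sub>F n in sequentially. D n = ?\<rho> n * h n"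
    using bound by eventually_elim auto
qed

theorem proposition2p1:
  fixes \<nu> :: "'x measure" and p :: "real ^ 'd::finite \<Rightarrow> 'x \<Rightarrow> real"
    and w :: "real ^ 'd \<Rightarrow> real" and \<Omega> :: "(real ^ 'd) set" and \<theta>\<^sub>0 :: "real ^ 'd"
    and I_half :: "real ^ 'd ^ 'd" and T :: "nat \<Rightarrow> (nat \<Rightarrow> 'x) \<Rightarrow> real ^ 'd"
    and F :: "(real ^ 'd) measure \<Rightarrow> real"
  assumes regular: "regular_model \<nu> p w \<Omega> \<theta>\<^sub>0"
    and sqrt_fisher: "is_pd_sqrt I_half (fisher \<nu> p \<theta>\<^sub>0)"
    and mle: "\<And>n. 1 \<le> n \<Longrightarrow> is_mle \<nu> p \<Omega> \<theta>\<^sub>0 n (T n)"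
  shows
    "(\<forall>J n. 1 \<le> J \<and> johnson_expandable \<nu> p w \<Omega> \<theta>\<^sub>0 I_half T J \<and> 1 \<le> n \<and>
        (\<forall>z z'. F (mvn z (approx_cov \<nu> p \<theta>\<^sub>0 n)) = F (mvn z' (approx_cov \<nu> p \<theta>\<^sub>0 n))) \<and>
        integrable (sample_law \<nu> p \<theta>\<^sub>0 n) (\<lambda>xs. F (posterior p w \<Omega> n xs)) \<and>
        integrable (sample_law \<nu> p \<theta>\<^sub>0 n) (approx_error \<nu> p w \<Omega> \<theta>\<^sub>0 T F n) \<longrightarrow>
        (LINT xs|sample_law \<nu> p \<theta>\<^sub>0 n. F (posterior p w \<Omega> n xs)) =
          F (mvn 0 (approx_cov \<nu> p \<theta>\<^sub>0 n)) +
          (LINT xs|sample_law \<nu> p \<theta>\<^sub>0 n. approx_error \<nu> p w \<Omega> \<theta>\<^sub>0 T F n xs))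
     \<and>
     (\<forall>K \<kappa>. 1 \<le> K \<and> edgeworth_expansion \<nu> p \<Omega> \<theta>\<^sub>0 I_half T \<kappa> K \<and>
        (\<forall>\<^sub>F n in sequentially.
           integrable (sample_law \<nu> p \<theta>\<^sub>0 n) (\<lambda>xs. F (posterior p w \<Omega> n xs)) \<and>
           integrable (sample_law \<nu> p \<theta>\<^sub>0 n) (approx_error \<nu> p w \<Omega> \<theta>\<^sub>0 T F n) \<and>
           integrable std_mvn (\<lambda>z. F (shifted_normal I_half \<theta>\<^sub>0 n z)) \<and>
           (\<forall>k\<in>{1..K}. integrable std_mvn
              (\<lambda>z. F (shifted_normal I_half \<theta>\<^sub>0 n z) * edgeworth_poly \<kappa> k (- z))) \<and>
           integrable lborel (h_integrand F I_half \<theta>\<^sub>0 K n)) \<longrightarrow>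
        (\<exists>\<rho>. \<rho> \<in> o(\<lambda>n. real n powr (- real K / 2)) \<and>
           (\<forall>\<^sub>F n in sequentially.
              (LINT xs|sample_law \<nu> p \<theta>\<^sub>0 n. F (posterior p w \<Omega> n xs)) =
                (LINT z|std_mvn. F (shifted_normal I_half \<theta>\<^sub>0 n z)) +
                (\<Sum>k=1..K. real n powr (- real k / 2) *
                   (LINT z|std_mvn. F (shifted_normal I_half \<theta>\<^sub>0 n z) * edgeworth_poly \<kappa> k (- z))) +
                \<rho> n * h_factor (\<lambda>M. \<bar>F M\<bar>) I_half \<theta>\<^sub>0 K n +
                (LINT xs|sample_law \<nu> p \<theta>\<^sub>0 n. approx_error \<nu> p w \<Omega> \<theta>\<^sub>0 T F n xs))))"
proof (intro conjI allI impI; elim conjE)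
  fix J n
  assume F_const: "\<forall>z z'. F (mvn z (approx_cov \<nu> p \<theta>\<^sub>0 n)) = F (mvn z' (approx_cov \<nu> p \<theta>\<^sub>0 n))"
    and post: "integrable (sample_law \<nu> p \<theta>\<^sub>0 n) (\<lambda>xs. F (posterior p w \<Omega> n xs))"
  interpret prob_space "sample_law \<nu> p \<theta>\<^sub>0 n"
    by (rule prob_space_sample_law[OF regular])
  have "approx_error \<nu> p w \<Omega> \<theta>\<^sub>0 T F n =
      (\<lambda>xs. F (posterior p w \<Omega> n xs) - F (mvn 0 (approx_cov \<nu> p \<theta>\<^sub>0 n)))"
    unfolding approx_error_def using F_const by (intro ext) metis
  then show "expectation (\<lambda>xs. F (posterior p w \<Omega> n xs)) =
      F (mvn 0 (approx_cov \<nu> p \<theta>\<^sub>0 n)) + expectation (approx_error \<nu> p w \<Omega> \<theta>\<^sub>0 T F n)"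
    using post by (simp add: prob_space)
next
  fix K :: nat and \<kappa> :: "(real ^ 'd) measure"
  assume EE: "edgeworth_expansion \<nu> p \<Omega> \<theta>\<^sub>0 I_half T \<kappa> K"
    and integrability: "\<forall>\<^sub>F n in sequentially.
           integrable (sample_law \<nu> p \<theta>\<^sub>0 n) (\<lambda>xs. F (posterior p w \<Omega> n xs)) \<and>
           integrable (sample_law \<nu> p \<theta>\<^sub>0 n) (approx_error \<nu> p w \<Omega> \<theta>\<^sub>0 T F n) \<and>
           integrable std_mvn (\<lambda>z. F (shifted_normal I_half \<theta>\<^sub>0 n z)) \<and>
           (\<forall>k\<in>{1..K}. integrable std_mvn
              (\<lambda>z. F (shifted_normal I_half \<theta>\<^sub>0 n z) * edgeworth_poly \<kappa> k (- z))) \<and>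
           integrable lborel (h_integrand F I_half \<theta>\<^sub>0 K n)"
  let ?P = "\<lambda>n. sample_law \<nu> p \<theta>\<^sub>0 n" and ?A = "fisher \<nu> p \<theta>\<^sub>0" and ?Q = "edgeworth_poly \<kappa>"
  let ?G = "\<lambda>n z. F (shifted_normal I_half \<theta>\<^sub>0 n z)" and ?c = "\<lambda>n k. real n powr (- real k / 2)"
  let ?h = "\<lambda>n. h_factor (\<lambda>M. \<bar>F M\<bar>) I_half \<theta>\<^sub>0 K n"
  let ?N = "\<lambda>n. LINT xs|?P n. F (mvn (T n xs) (approx_cov \<nu> p \<theta>\<^sub>0 n))"
  let ?E = "\<lambda>n. (LINT z|std_mvn. ?G n z) + (\<Sum>k=1..K. ?c n k * (LINT z|std_mvn. ?G n z * ?Q k (- z)))"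
  interpret regular_model \<nu> p w \<Omega> \<theta>\<^sub>0 by (rule regular)
  obtain \<delta> where \<delta>: "0 < \<delta>" "ball \<theta>\<^sub>0 \<delta> \<subseteq> \<Omega>"
    using interior_param by (auto simp: mem_interior)
  then have \<theta>\<^sub>0: "\<theta>\<^sub>0 \<in> \<Omega>" by auto
  obtain L where L: "0 < L" "\<And>z. norm (matrix_inv I_half *v z) \<le> L * norm z"
    using bounded_linear.pos_bounded[OF matrix_vector_mul_bounded_linear[of "matrix_inv I_half"]]
    by (auto simp: mult.commute)
  have "real_polynomial_function (\<lambda>z. ?Q k (- z))" for k
    using real_polynomial_function_compose[OF polynomial_function_minus[OF polynomial_function_id]
        real_polynomial_function_edgeworth_poly[of \<kappa> k]] by (simp add: o_def)
  \<comment> \<open>\<open>M\<close> is fixed before n: uniformity in the coefficients makes it a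
    genuine constant in \<open>\<eta>\<close>.\<close>
  then obtain M where M: "0 \<le> M" "\<And>c z. (\<forall>k\<in>{1..K}. \<bar>c k\<bar> \<le> 1) \<Longrightarrow>
      \<bar>(1 + (\<Sum>k=1..K. c k * ?Q k (- z))) * std_mvn_density z\<bar> * (1 + norm z ^ K) * norm z ^ Suc K \<le> M"
    using gaussian_expansion_tail[of "{1..K}" "\<lambda>k z. ?Q k (- z)" K] by auto
  obtain f e \<epsilon> where \<epsilon>: "\<epsilon> \<in> o(\<lambda>n. real n powr (- real K / 2))"
    and expansion: "\<forall>\<^sub>F n in sequentially.
           (\<forall>\<theta>. 0 \<le> f n \<theta>) \<and>
           distributed (?P n) lborel (T n) (\<lambda>\<theta>. ennreal (f n \<theta>)) \<and>
           (\<forall>\<theta>\<in>\<Omega>. let v = sqrt (real n) *\<^sub>R (I_half *v (\<theta> - \<theta>\<^sub>0));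
                        g = mvn_density \<theta>\<^sub>0 (approx_cov \<nu> p \<theta>\<^sub>0 n) \<theta> in
              f n \<theta> = g + (\<Sum>k=1..K. ?c n k * ?Q k v * g)
                     + e n \<theta> * sqrt (det (real n *\<^sub>R ?A)) / (1 + norm v ^ (K + 2)) \<and>
              \<bar>e n \<theta>\<bar> \<le> \<epsilon> n)"
    using EE unfolding edgeworth_expansion_def by blast
  \<comment> \<open>The first term is the Edgeworth remainder after its weight is lowered, the
    second the contribution from off \<Omega>, which is smaller than the target rate by a factor
    n^(-1/2).\<close>
  define \<eta> where "\<eta> n = 2 * \<epsilon> n + M * (L / \<delta>) ^ Suc K * real n powr (- (real K + 1) / 2)" for n
  have "(\<lambda>n. M * (L / \<delta>) ^ Suc K * real n powr (- (real K + 1) / 2)) \<in>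
      O(\<lambda>n. real n powr (- (real K + 1) / 2))"
    by (rule bigoI[of _ "\<bar>M * (L / \<delta>) ^ Suc K\<bar>"]) (simp add: abs_mult)
  also have "(\<lambda>n. real n powr (- (real K + 1) / 2)) \<in> o(\<lambda>n. real n powr (- real K / 2))"
    by (subst powr_smallo_iff[OF filterlim_real_sequentially]) simp_all
  finally have rest: "(\<lambda>n. M * (L / \<delta>) ^ Suc K * real n powr (- (real K + 1) / 2)) \<in>
      o(\<lambda>n. real n powr (- real K / 2))" .
  have "(\<lambda>n. 2 * \<epsilon> n) \<in> o(\<lambda>n. real n powr (- real K / 2))" using \<epsilon> by simp
  from sum_in_smallo(1)[OF this rest] have \<eta>: "\<eta> \<in> o(\<lambda>n. real n powr (- real K / 2))"
    by (simp only: \<eta>_def[abs_def])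
  have bound: "\<forall>\<^sub>F n in sequentially. \<bar>?N n - ?E n\<bar> \<le> \<eta> n * ?h n \<and> 0 \<le> ?h n \<and> 0 \<le> \<eta> n"
    using expansion integrability eventually_ge_at_top[of 1]
  proof eventually_elim
    case (elim n)
    interpret prob_space "?P n" by (rule prob_space_sample_law[OF regular])
    let ?B = "sqrt (real n) *\<^sub>R I_half"
    have n: "1 \<le> n" and f: "\<And>\<theta>. 0 \<le> f n \<theta>"
      and D: "distributed (?P n) lborel (T n) (\<lambda>\<theta>. ennreal (f n \<theta>))"
      using elim by auto
    have cov: "approx_cov \<nu> p \<theta>\<^sub>0 n = matrix_inv (real n *\<^sub>R ?A)"
      by (simp add: approx_cov_def)
    have dens: "f n \<theta> = mvn_density \<theta>\<^sub>0 (approx_cov \<nu> p \<theta>\<^sub>0 n) \<theta> +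
          (\<Sum>k=1..K. ?c n k * ?Q k (sqrt (real n) *\<^sub>R (I_half *v (\<theta> - \<theta>\<^sub>0))) *
            mvn_density \<theta>\<^sub>0 (approx_cov \<nu> p \<theta>\<^sub>0 n) \<theta>) +
          e n \<theta> * sqrt (det (real n *\<^sub>R ?A)) /
            (1 + norm (sqrt (real n) *\<^sub>R (I_half *v (\<theta> - \<theta>\<^sub>0))) ^ (K + 2))"
      and e: "\<bar>e n \<theta>\<bar> \<le> \<epsilon> n" if "\<theta> \<in> \<Omega>" for \<theta>
      using elim(1) that by (auto simp: Let_def)
    \<comment> \<open>The remainder bound is available at the point \<open>\<theta>\<^sub>0\<close>
      of \<Omega>, so \<open>\<epsilon> n\<close> dominates an absolute value.\<close>
    have \<epsilon>_nonneg: "0 \<le> \<epsilon> n" using e[OF \<theta>\<^sub>0] by linarith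
    have inside: "\<bar>f n \<theta> - (1 + (\<Sum>k=1..K. ?c n k * ?Q k (sqrt (real n) *\<^sub>R (I_half *v (\<theta> - \<theta>\<^sub>0))))) *
          mvn_density \<theta>\<^sub>0 (matrix_inv (real n *\<^sub>R ?A)) \<theta>\<bar>
        \<le> \<epsilon> n * sqrt (det (real n *\<^sub>R ?A)) / (1 + norm (sqrt (real n) *\<^sub>R (I_half *v (\<theta> - \<theta>\<^sub>0))) ^ (K + 2))"
      if "\<theta> \<in> \<Omega>" for \<theta>
    proof -
      let ?v = "sqrt (real n) *\<^sub>R (I_half *v (\<theta> - \<theta>\<^sub>0))"
      have "det (real n *\<^sub>R ?A) = (det ?B)\<^sup>2"
        unfolding is_pd_sqrt_scaled(2)[OF sqrt_fisher n, symmetric] by (simp only: det_mul power2_eq_square)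
      then have "0 \<le> sqrt (det (real n *\<^sub>R ?A))" by simp
      then have "\<bar>e n \<theta> * sqrt (det (real n *\<^sub>R ?A)) / (1 + norm ?v ^ (K + 2))\<bar>
          \<le> \<epsilon> n * sqrt (det (real n *\<^sub>R ?A)) / (1 + norm ?v ^ (K + 2))"
        using e[OF that] unfolding abs_divide abs_mult
        by (intro frac_le mult_mono) (auto intro: add_pos_nonneg)
      then show ?thesis
        unfolding dens[OF that] cov by (simp only: distrib_right sum_distrib_right mult_1_left add_diff_cancel_left')
    qed
    \<comment> \<open>A maximum likelihood estimator takes values in \<Omega> almost surely, which
      forces its density to vanish almost everywhere off \<Omega>; closedness makes \<Omega>
      measurable.\<close>
    have "AE xs in ?P n. T n xs \<in> \<Omega>"
      using mle[OF n] unfolding is_mle_def by (auto elim: eventually_mono)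
    moreover have "Measurable.pred lborel (\<lambda>\<theta>. \<theta> \<in> \<Omega>)"
      using closed_param by (simp add: pred_def)
    ultimately have "AE \<theta> in lborel. 0 < ennreal (f n \<theta>) \<longrightarrow> \<theta> \<in> \<Omega>"
      using distributed_AE2[OF D] by blast
    then have outside: "AE \<theta> in lborel. \<theta> \<notin> \<Omega> \<longrightarrow> f n \<theta> = 0"
      by eventually_elim (use f in \<open>auto simp: less_le\<close>)
    have "\<forall>k\<in>{1..K}. \<bar>?c n k\<bar> \<le> 1"
    proof
      fix k
      have "real n powr (- real k / 2) \<le> real n powr 0" using n by (intro powr_mono) auto
      then show "\<bar>?c n k\<bar> \<le> 1" using n by simp
    qed
    note tail = M(2)[OF this]
    have density_bound: "AE z in lborel. \<bar>f n (\<theta>\<^sub>0 - matrix_inv ?B *v z) / \<bar>det ?B\<bar> -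
        (1 + (\<Sum>k=1..K. ?c n k * ?Q k (- z))) * std_mvn_density z\<bar> \<le> \<eta> n / (1 + norm z ^ K)"
      unfolding \<eta>_def
      by (rule edgeworth_density_bound[OF sqrt_fisher n L \<delta> M(1) tail outside inside \<epsilon>_nonneg])
    have cov': "approx_cov \<nu> p \<theta>\<^sub>0 n = matrix_inv (?B ** ?B)"
      unfolding cov is_pd_sqrt_scaled(2)[OF sqrt_fisher n] ..
    \<comment> \<open>Integrability at the estimator is recovered as the difference of two
      integrable quantities: \<open>F\<close> at the posterior, and the approximation error.\<close>
    have FX: "integrable (?P n) (\<lambda>xs. F (mvn (T n xs) (matrix_inv (?B ** ?B))))"
    proof -
      have "integrable (?P n) (\<lambda>xs. F (posterior p w \<Omega> n xs) - approx_error \<nu> p w \<Omega> \<theta>\<^sub>0 T F n xs)"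
        using elim by (intro Bochner_Integration.integrable_diff) auto
      then show ?thesis by (simp add: approx_error_def cov')
    qed
    have G: "integrable std_mvn (?G n)"
      and GQ: "\<And>k. k \<in> {1..K} \<Longrightarrow> integrable std_mvn (\<lambda>z. ?G n z * ?Q k (- z))"
      and Gm: "integrable lborel (\<lambda>z. ?G n z / (1 + norm z ^ K))"
      using elim by (auto simp: h_integrand_def[abs_def])
    have h: "?h n = (LINT z|lborel. \<bar>?G n z\<bar> / (1 + norm z ^ K))"
      by (simp add: h_factor_def h_integrand_def)
    have "\<bar>?N n - ?E n\<bar> \<le> \<eta> n * ?h n"
      unfolding h cov'
      by (rule normal_at_estimator_expansion[OF is_pd_sqrt_scaled(1,3)[OF sqrt_fisher n] f D FX G GQ Gm density_bound])
    moreover have "0 \<le> ?h n"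
      unfolding h by (intro integral_nonneg_AE AE_I2) (auto intro!: divide_nonneg_nonneg add_nonneg_nonneg)
    moreover have "0 \<le> \<eta> n"
      unfolding \<eta>_def using \<epsilon>_nonneg M(1) L(1) \<delta>(1) by simp
    ultimately show ?case by blast
  qed
  obtain \<rho> where \<rho>: "\<rho> \<in> o(\<lambda>n. real n powr (- real K / 2))"
    "\<forall>\<^sub>F n in sequentially. ?N n - ?E n = \<rho> n * ?h n"
    using smallo_factor[OF bound \<eta>] by blast
  have "\<forall>\<^sub>F n in sequentially. (LINT xs|?P n. F (posterior p w \<Omega> n xs)) =
      ?E n + \<rho> n * ?h n + (LINT xs|?P n. approx_error \<nu> p w \<Omega> \<theta>\<^sub>0 T F n xs)"
    using \<rho>(2) integrability
  proof eventually_elim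
    case (elim n)
    have "?N n = (LINT xs|?P n. F (posterior p w \<Omega> n xs) - approx_error \<nu> p w \<Omega> \<theta>\<^sub>0 T F n xs)"
      by (simp add: approx_error_def)
    also have "\<dots> = (LINT xs|?P n. F (posterior p w \<Omega> n xs)) - (LINT xs|?P n. approx_error \<nu> p w \<Omega> \<theta>\<^sub>0 T F n xs)"
      using elim by (intro Bochner_Integration.integral_diff) auto
    finally show ?case using elim(1) by linarith
  qed
  with \<rho>(1) show "\<exists>\<rho>. \<rho> \<in> o(\<lambda>n. real n powr (- real K / 2)) \<and>
           (\<forall>\<^sub>F n in sequentially.
              (LINT xs|?P n. F (posterior p w \<Omega> n xs)) = ?E n + \<rho> n * ?h n +
                (LINT xs|?P n. approx_error \<nu> p w \<Omega> \<theta>\<^sub>0 T F n xs))"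
    by blast
qed

end
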